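(* Let $G\leq \mathrm{S}_d$ be a QI-group, acting on $\mathbb{R}^d$ by permuting coordinates. Then there is a constant $M$ depending only on the group $G$ such that every core point for $G$ (with respect to the lattice $\mathbb{Z}^d$) is normalizer equivalent to a core point $w$ with $\|w\|^2\leq M$. In particular, there are only finitely many core points for $G$ up to normalizer equivalence.
   Context: Identify $G\leq \mathrm{S}_d$ with a group of permutation matrices in $\mathrm{GL}(d,\mathbb{Z})$. $\mathrm{Fix}(G)=\{v\in\mathbb{R}^d : gv=v \text{ for all } g\in G\}$. A subspace of $\mathbb{R}^d$ is rational if it has a basis contained in $\mathbb{Q}^d$. A transitive permutation group $G\leq \mathrm{S}_d$ is a QI-group if $\mathrm{Fix}(G)^{\perp}$ contains no rational $G$-invariant subspace other than $\{0\}$ and $\mathrm{Fix}(G)^\perp$ itself. A core point for $G$ is a vector $z\in\mathbb{Z}^d$ such that $\mathrm{conv}\{gz : g\in G\}\cap \mathbb{Z}^d = Gz$, where $Gz=\{gz: g\in G\}$. Two points $z,w$ are normalizer equivalent if $w=Sz+b$ for some $b\in \mathrm{Fix}(G)\cap\mathbb{Z}^d$ and some $S$ in the normalizer $\mathbf{N}_{\mathrm{GL}(d,\mathbb{Z})}(G)=\{S\in\mathrm{GL}(d,\mathbb{Z}): S^{-1}gS\in G\ \text{for all } g\in G\}$. $\|\cdot\|$ is the standard Euclidean norm. *)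

theory Defs
  imports "HOL-Analysis.Analysis" "HOL-Algebra.Bij"
begin

text \<open>The degree \<open>d\<close> is \<open>CARD('n)\<close>, so that the symmetric group on \<open>d\<close> letters is
  \<open>BijGroup (UNIV :: 'n set)\<close>.\<close>

definition permutation_group :: "('n \<Rightarrow> 'n) set \<Rightarrow> bool" where
  "permutation_group G \<longleftrightarrow> subgroup G (BijGroup UNIV)"

definition transitive_group :: "('n \<Rightarrow> 'n) set \<Rightarrow> bool" where
  "transitive_group G \<longleftrightarrow> permutation_group G \<and> (\<forall>i j. \<exists>g\<in>G. g i = j)"

text \<open>The convention \<open>g e\<^sub>j = e\<^bsub>g j\<^esub>\<close> makes \<open>perm_matrix\<close> a homomorphism (a left action).\<close>

definition perm_matrix :: "('n::finite \<Rightarrow> 'n) \<Rightarrow> real ^ 'n ^ 'n" where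
  "perm_matrix g = (\<chi> i j. if i = g j then 1 else 0)"

lemma perm_matrix_axis: "perm_matrix g *v axis j 1 = axis (g j) 1"
  unfolding matrix_vector_mul_component matrix_vector_mult_basis
  by (simp add: perm_matrix_def column_def axis_def vec_eq_iff)

lemma perm_matrix_comp: "perm_matrix (g \<circ> h) = perm_matrix g ** perm_matrix h"
proof -
  have "(\<Sum>k\<in>UNIV. (if i = g k then 1 else 0) * (if k = h j then 1 else 0)) =
        (if i = g (h j) then 1 else (0::real))" for i j
    by (subst sum.mono_neutral_right[of UNIV "{h j}"]) auto
  then show ?thesis
    by (simp add: perm_matrix_def matrix_matrix_mult_def vec_eq_iff)
qed

definition int_lattice :: "(real ^ 'n) set" where
  "int_lattice = {v. \<forall>i. v $ i \<in> \<int>}"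

definition Fix :: "('n::finite \<Rightarrow> 'n) set \<Rightarrow> (real ^ 'n) set" where
  "Fix G = {v. \<forall>g\<in>G. perm_matrix g *v v = v}"

definition rational_subspace :: "(real ^ 'n) set \<Rightarrow> bool" where
  "rational_subspace V \<longleftrightarrow>
     (\<exists>B. (\<forall>b\<in>B. \<forall>i. b $ i \<in> \<rat>) \<and> independent B \<and> span B = V)"

definition invariant_under :: "('n::finite \<Rightarrow> 'n) set \<Rightarrow> (real ^ 'n) set \<Rightarrow> bool" where
  "invariant_under G V \<longleftrightarrow> (\<forall>g\<in>G. \<forall>v\<in>V. perm_matrix g *v v \<in> V)"

definition QI_group :: "('n::finite \<Rightarrow> 'n) set \<Rightarrow> bool" where
  "QI_group G \<longleftrightarrow> transitive_group G \<and>
     (\<forall>V. rational_subspace V \<and> invariant_under G V \<and> V \<subseteq> (Fix G)\<^sup>\<bottom> \<longrightarrow>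
          V = {0} \<or> V = (Fix G)\<^sup>\<bottom>)"

definition orbit_of :: "('n::finite \<Rightarrow> 'n) set \<Rightarrow> real ^ 'n \<Rightarrow> (real ^ 'n) set" where
  "orbit_of G z = (\<lambda>g. perm_matrix g *v z) ` G"

definition core_point :: "('n::finite \<Rightarrow> 'n) set \<Rightarrow> real ^ 'n \<Rightarrow> bool" where
  "core_point G z \<longleftrightarrow>
     z \<in> int_lattice \<and> convex hull (orbit_of G z) \<inter> int_lattice = orbit_of G z"

text \<open>\<open>GL(d,\<int>)\<close> as a set of real matrices.\<close>

definition GL_int :: "(real ^ 'n ^ 'n) set" where
  "GL_int = {S. invertible S \<and> (\<forall>i j. S $ i $ j \<in> \<int>) \<and> (\<forall>i j. matrix_inv S $ i $ j \<in> \<int>)}"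

definition GL_normalizer :: "('n::finite \<Rightarrow> 'n) set \<Rightarrow> (real ^ 'n ^ 'n) set" where
  "GL_normalizer G =
     {S \<in> GL_int. \<forall>g\<in>G. matrix_inv S ** perm_matrix g ** S \<in> perm_matrix ` G}"

definition normalizer_equivalent ::
    "('n::finite \<Rightarrow> 'n) set \<Rightarrow> real ^ 'n \<Rightarrow> real ^ 'n \<Rightarrow> bool" where
  "normalizer_equivalent G z w \<longleftrightarrow>
     (\<exists>S\<in>GL_normalizer G. \<exists>b\<in>Fix G \<inter> int_lattice. w = S *v z + b)"

end

theory Submission
  imports Defs
begin

text \<open>
  Write \<open>d\<close> for the degree and \<open>W\<close> for the space of vectors with coordinate sum zero, which for a transitive group is the orthogonal
  complement of the fixed space.  Two facts are played against each other.

  A core point \<open>w\<close> is narrow.  Some integral point near the barycentre of the orbit of \<open>w\<close> has the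
  same coordinate sum; if it lies in the hull of the orbit then it is in the orbit, and the
  \<open>W\<close>-component of \<open>w\<close> is bounded.  Otherwise a hyperplane separates it from the hull, and since the
  \<open>W\<close>-components of an orbit sum to zero, this gives a unit vector \<open>v\<close> in \<open>W\<close> such that all
  \<open>\<langle>g v, w\<rangle>\<close> are bounded by a constant (\<open>core_point_narrow\<close>).  Hence the operator
  \<open>Q = \<Sum>g. (g v)(g v)\<^sup>T\<close>, which commutes with the group, maps \<open>w\<close> to a bounded vector, although
  it is not small itself.  For a small number \<open>s\<close> and a large number \<open>t\<close>, the operator
  \<open>A = s + t Q\<close> on \<open>W\<close> expands volume but satisfies \<open>|A w| \<le> s |w| + const\<close>.

  On the other side stand the units: integral matrices that commute with the group, fix the
  all-one vector and have an integral inverse.  They are cocompact: for each symmetric operator \<open>A\<close>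
  in the commutant of the group on \<open>W\<close> that expands volume enough there is a unit \<open>u\<close> with
  \<open>|u x| \<le> c |A x|\<close> on \<open>W\<close>, where \<open>c\<close> depends on the group only (\<open>unit_approximation\<close>).  By the
  QI property each nonzero rational operator in the commutant is invertible on \<open>W\<close>, because its
  range is a rational invariant subspace; so the rational commutant is a division algebra, and
  Minkowski's argument applies to it directly.  After \<open>A\<close> has been scaled
  down to a volume distortion that depends on the group only, Blichfeldt's theorem yields a nonzero
  integral \<open>X = C A\<close> with \<open>C\<close> bounded.  Then \<open>X\<close> has bounded volume distortion too, so a second
  application of Blichfeldt's theorem yields an integral \<open>Z\<close> and a bounded integer \<open>k \<noteq> 0\<close> with \<open>Z X = k d\<close> on \<open>W\<close>.  Two such \<open>X\<close> which are congruent modulo a fixed number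
  differ by a unit, so up to units only finitely many \<open>X\<close> occur, and these are bounded below.

  Now move a core point by a unit so that its norm becomes minimal.  For the resulting point \<open>w\<close>,
  with \<open>W\<close>-component \<open>w'\<close>, the two facts together give
  \<open>|w'| \<le> |u w'| \<le> c |A w'| \<le> c s |w'| + const\<close>, and \<open>c s = 1/2\<close> bounds \<open>|w'|\<close>.  A
  translation by an integral fixed vector bounds the mean.

  The commutant on \<open>W\<close> is identified with a space of vectors in \<open>\<real>\<^sup>d\<close> by taking
  the row of a matrix at the base point; this row is fixed by the stabilizer of the base point.  The
  lattice of integral elements then becomes a sublattice of \<open>\<int>\<^sup>d\<close>, right multiplication by \<open>A\<close> becomes
  \<open>A\<^sup>T\<close>, and volumes are computed in \<open>\<real>\<^sup>d\<close>.
\<close>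

section \<open>The scaling factor of a linear map\<close>

text \<open>Linear images scale Lebesgue measure by a constant factor, which is treated as an abstract number,
  multiplicative under composition and estimated from images of the unit ball.\<close>
definition has_modulus :: "('a::euclidean_space \<Rightarrow> 'a) \<Rightarrow> real \<Rightarrow> bool" where
  "has_modulus f m \<longleftrightarrow>
     (\<forall>S\<in>lmeasurable. f ` S \<in> lmeasurable \<and> measure lebesgue (f ` S) = m * measure lebesgue S)"

lemma has_modulusI_cbox:
  assumes "linear f" "\<And>a b. measure lebesgue (f ` cbox a b) = m * measure lebesgue (cbox a b)"
  shows "has_modulus f m"
  unfolding has_modulus_def
  using measure_linear_sufficient[OF assms(1) _ assms(2)] by metis

lemma has_modulus_comp:
  assumes "has_modulus f k" "has_modulus g m"
  shows "has_modulus (f \<circ> g) (k * m)"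
  using assms unfolding has_modulus_def image_comp[symmetric] by (auto simp: mult.assoc)

lemma has_modulus_singular:
  assumes "linear f" "\<not> inj f"
  shows "has_modulus f 0"
proof -
  have "negligible (f ` S)" for S
    using assms by (rule negligible_linear_singular_image)
  then show ?thesis
    unfolding has_modulus_def
    by (auto simp: negligible_imp_measurable negligible_imp_measure0)
qed

lemma has_modulus_transposition:
  "has_modulus (\<lambda>v::real^'n. \<chi> i. v $ Transposition.transpose m n i) 1" (is "has_modulus ?h 1")
proof (rule has_modulusI_cbox)
  show "linear ?h"
    by (rule linearI) (simp_all add: plus_vec_def scaleR_vec_def)
  show "measure lebesgue (?h ` cbox a b) = 1 * measure lebesgue (cbox a b)" for a b
  proof (cases "cbox a b = {}")
    case False
    have eq: "?h ` (cbox a b) = cbox (?h a) (?h b)"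
      by (auto simp: image_iff lambda_swap_Galois mem_box_cart) (metis transpose_involutory)+
    then have ne: "cbox (?h a) (?h b) \<noteq> {}"
      using False by blast
    have "(\<Prod>i\<in>UNIV. b $ Transposition.transpose m n i - a $ Transposition.transpose m n i) =
          (\<Prod>i\<in>UNIV. b $ i - a $ i)"
      by (rule prod.reindex_bij_betw) simp
    then show ?thesis
      by (simp add: eq content_cbox_cart False ne)
  qed simp
qed

lemma has_modulus_shear:
  assumes "m \<noteq> n"
  shows "has_modulus (\<lambda>v::real^'n. \<chi> i. if i = m then v $ m + v $ n else v $ i) 1"
    (is "has_modulus ?h 1")
proof (rule has_modulusI_cbox)
  show lin: "linear ?h"
    by (rule linearI) (simp_all add: algebra_simps vec_eq_iff)
  show "measure lebesgue (?h ` cbox a b) = 1 * measure lebesgue (cbox a b)" for a b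
  proof (cases "cbox a b = {}")
    case False
    (* Translating the box makes its lower n-th coordinate nonnegative, as the shear lemma needs. *)
    define t where "t = axis n (- (a $ n))"
    have "(+) (?h t) ` ?h ` cbox a b = ?h ` (+) t ` cbox a b"
      by (simp add: image_image linear_add[OF lin])
    then have "measure lebesgue ((+) (?h t) ` ?h ` cbox a b) = measure lebesgue (?h ` (+) t ` cbox a b)"
      by simp
    then have "measure lebesgue (?h ` cbox a b) = measure lebesgue (?h ` (+) t ` cbox a b)"
      unfolding measure_translation .
    also have "\<dots> = measure lebesgue (?h ` cbox (t + a) (t + b))"
      by (simp only: cbox_translation)
    also have "\<dots> = measure lebesgue (cbox (t + a) (t + b))"
    proof (rule measure_shear_interval)
      show "cbox (t + a) (t + b) \<noteq> {}"
        using False by (simp add: cbox_translation)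
      show "0 \<le> (t + a) $ n"
        by (simp add: t_def)
    qed (fact assms)
    also have "\<dots> = measure lebesgue ((+) t ` cbox a b)"
      by (simp only: cbox_translation)
    also have "\<dots> = 1 * measure lebesgue (cbox a b)"
      by (simp only: measure_translation)
    finally show ?thesis .
  qed simp
qed

lemma linear_has_modulus:
  fixes f :: "real^'n \<Rightarrow> real^'n"
  assumes "linear f"
  shows "\<exists>m. has_modulus f m"
proof (rule induct_linear_elementary[OF assms])
  show "\<exists>m. has_modulus (f \<circ> g) m"
    if "\<exists>m. has_modulus f m" "\<exists>m. has_modulus g m" for f g :: "real^'n \<Rightarrow> real^'n"
    using that has_modulus_comp by blast
  show "\<exists>m. has_modulus f m" if "linear f" "\<And>x. f x $ i = 0" for f :: "real^'n \<Rightarrow> real^'n" and i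
  proof -
    have "\<not> surj f"
      using that(2) by (metis surjD one_neq_zero vec_component)
    then show ?thesis
      using that(1) has_modulus_singular linear_injective_imp_surjective by blast
  qed
  show "\<exists>m. has_modulus (\<lambda>x::real^'n. \<chi> i. c i * x $ i) m" for c
    unfolding has_modulus_def
    by (rule exI[of _ "\<bar>prod c UNIV\<bar>"]) (simp add: measurable_stretch measure_stretch)
  show "\<exists>m'. has_modulus (\<lambda>x::real^'n. \<chi> i. x $ Transposition.transpose m n i) m'" for m n
    using has_modulus_transposition by blast
  show "\<exists>m'. has_modulus (\<lambda>x::real^'n. \<chi> i. if i = m then x $ m + x $ n else x $ i) m'"
    if "m \<noteq> n" for m n
    using has_modulus_shear[OF that] by blast
qed

text \<open>For linear \<open>f\<close>, the absolute value of the determinant.\<close>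
definition modulus :: "('a::euclidean_space \<Rightarrow> 'a) \<Rightarrow> real" where
  "modulus f = measure lebesgue (f ` cball 0 1) / measure lebesgue (cball (0::'a) 1)"

lemma measure_cball_scale:
  fixes c :: "'a::euclidean_space"
  assumes "r \<ge> 0"
  shows "measure lebesgue (cball c r) = r ^ DIM('a) * measure lebesgue (cball (0::'a) 1)"
  using content_ball_conv_unit_ball[OF assms, of c]
  by (simp add: content_cball_conv_ball)

lemma measure_unit_cball_pos: "measure lebesgue (cball (0::'a::euclidean_space) 1) > 0"
  by (simp add: content_cball_pos)

lemma has_modulus_modulus:
  fixes f :: "real^'n \<Rightarrow> real^'n"
  assumes "linear f"
  shows "has_modulus f (modulus f)"
proof -
  obtain m where m: "has_modulus f m"
    using linear_has_modulus[OF assms] by blast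
  then have "measure lebesgue (f ` cball 0 1) = m * measure lebesgue (cball (0::real^'n) 1)"
    by (simp add: has_modulus_def)
  then have "modulus f = m"
    using measure_unit_cball_pos[where ?'a = "real^'n"] by (simp add: modulus_def)
  with m show ?thesis by simp
qed

lemma
  fixes f :: "real^'n \<Rightarrow> real^'n"
  assumes "linear f" "S \<in> lmeasurable"
  shows lmeasurable_linear_image: "f ` S \<in> lmeasurable"
    and measure_linear_image_modulus: "measure lebesgue (f ` S) = modulus f * measure lebesgue S"
  using has_modulus_modulus[OF assms(1)] assms(2) by (auto simp: has_modulus_def)

lemma modulus_comp:
  fixes f g :: "real^'n \<Rightarrow> real^'n"
  assumes "linear f" "linear g"
  shows "modulus (f \<circ> g) = modulus f * modulus g"
proof -
  have "measure lebesgue (f ` g ` cball 0 1) = modulus f * measure lebesgue (g ` cball 0 1)"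
    using assms by (intro measure_linear_image_modulus lmeasurable_linear_image) auto
  then show ?thesis
    by (simp add: modulus_def image_comp)
qed

lemma modulus_id: "modulus (id :: 'a::euclidean_space \<Rightarrow> 'a) = 1"
  using measure_unit_cball_pos[where ?'a = 'a] by (simp add: modulus_def)

lemma modulus_nonneg: "modulus f \<ge> 0"
  by (simp add: modulus_def)

lemma modulus_le:
  fixes f :: "real^'n \<Rightarrow> real^'n"
  assumes "linear f" "\<And>x. norm (f x) \<le> r * norm x" "r \<ge> 0"
  shows "modulus f \<le> r ^ CARD('n)"
proof -
  have "f ` cball 0 1 \<subseteq> cball 0 r"
  proof clarsimp
    fix x :: "real^'n" assume "norm x \<le> 1"
    then have "r * norm x \<le> r" using assms(3) by (simp add: mult_left_le)
    then show "norm (f x) \<le> r" using assms(2)[of x] by linarith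
  qed
  then have "measure lebesgue (f ` cball 0 1) \<le> measure lebesgue (cball (0::real^'n) r)"
    by (intro measure_mono_fmeasurable fmeasurableD lmeasurable_linear_image assms) auto
  then show ?thesis
    using measure_unit_cball_pos[where ?'a = "real^'n"] measure_cball_scale[OF assms(3), of "0::real^'n"]
    by (simp add: modulus_def field_simps)
qed

lemma modulus_inverse:
  fixes f g :: "real^'n \<Rightarrow> real^'n"
  assumes "linear f" "linear g" "f \<circ> g = id"
  shows "modulus f * modulus g = 1"
  using modulus_comp[OF assms(1,2)] assms(3) modulus_id by metis

text \<open>The balls are disjoint because consecutive centres are further apart than a diameter.\<close>
lemma measure_ge_ball_progression:
  fixes u :: "'a::euclidean_space"
  assumes r: "r > 0" "norm u > 2 * r"
    and S: "S \<in> lmeasurable" "\<And>k. k \<le> (K::nat) \<Longrightarrow> cball (real k *\<^sub>R u) r \<subseteq> S"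
  shows "measure lebesgue S \<ge> (real K + 1) * r ^ DIM('a) * measure lebesgue (cball (0::'a) 1)"
proof -
  let ?B = "\<lambda>k::nat. cball (real k *\<^sub>R u) r"
  have disj: "?B i \<inter> ?B j = {}" if "i \<noteq> j" for i j
  proof (rule ccontr)
    assume "?B i \<inter> ?B j \<noteq> {}"
    then obtain x where "dist (real i *\<^sub>R u) x \<le> r" "dist (real j *\<^sub>R u) x \<le> r" by auto
    then have "dist (real i *\<^sub>R u) (real j *\<^sub>R u) \<le> 2 * r"
      by (smt (verit) dist_triangle2)
    then have le: "\<bar>real i - real j\<bar> * norm u \<le> 2 * r"
      by (simp add: dist_norm scaleR_left_diff_distrib[symmetric])
    have "\<bar>real i - real j\<bar> \<ge> 1" using that by linarith
    then have "\<bar>real i - real j\<bar> * norm u \<ge> norm u"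
      using mult_right_mono[of 1 "\<bar>real i - real j\<bar>" "norm u"] by simp
    with le r show False by linarith
  qed
  have "(real K + 1) * r ^ DIM('a) * measure lebesgue (cball (0::'a) 1)
        = (\<Sum>k\<in>{..K}. measure lebesgue (?B k))"
    unfolding measure_cball_scale[OF less_imp_le[OF r(1)]] by (simp only: sum_constant card_atMost) simp
  also have "\<dots> = measure lebesgue (\<Union>k\<in>{..K}. ?B k)"
    by (rule measure_negligible_finite_Union_image[symmetric]) (auto simp: pairwise_def disj)
  also have "\<dots> \<le> measure lebesgue S"
    using S by (intro measure_mono_fmeasurable) auto
  finally show ?thesis .
qed

text \<open>The image of the unit ball contains a ball of radius \<open>s\<close> and, by convexity, its hull with the long
  vector \<open>f e\<close>.  A progression of balls of radius \<open>s / 2\<close> along this vector fits into the hull.\<close>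
lemma modulus_ge:
  fixes f :: "real^'n \<Rightarrow> real^'n"
  assumes f: "linear f" "\<And>x. norm (f x) \<ge> s * norm x" and s: "s > 0"
    and e: "norm e = 1" "norm (f e) \<ge> 4 * s * real K"
  shows "modulus f \<ge> (real K + 1) * (s / 2) ^ CARD('n)"
proof -
  have inj: "inj f"
  proof (rule linear_injective_0[THEN iffD2, OF f(1)], safe)
    fix x assume "f x = 0"
    with f(2)[of x] s show "x = 0" by (simp add: mult_le_0_iff)
  qed
  then have surj: "surj f"
    using f(1) linear_injective_imp_surjective by blast
  have ball: "cball 0 s \<subseteq> f ` cball 0 1"
  proof
    fix y :: "real^'n" assume y: "y \<in> cball 0 s"
    obtain x where x: "y = f x" using surj by (metis surjD)
    then have "s * norm x \<le> s" using f(2)[of x] y by simp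
    then have "norm x \<le> 1" using s by simp
    with x show "y \<in> f ` cball 0 1" by auto
  qed
  have conv: "convex (f ` cball 0 1)"
    by (rule convex_linear_image[OF f(1)]) auto
  have fe0: "norm (f e) > 0"
    using less_le_trans[of 0 s "norm (f e)"] f(2)[of e] e s by simp
  (* Half of a point of the segment plus half of a point of the ball of radius s stays in the
     image: hence balls of radius s / 2, with centres in the first half of the segment. *)
  define u where "u = (2 * s / norm (f e)) *\<^sub>R f e"
  have nu: "norm u = 2 * s"
    using fe0 s by (simp add: u_def)
  have sub: "cball (real k *\<^sub>R u) (s / 2) \<subseteq> f ` cball 0 1" if "k \<le> K" for k
  proof
    fix y assume "y \<in> cball (real k *\<^sub>R u) (s / 2)"
    then have "norm (2 *\<^sub>R (y - real k *\<^sub>R u)) \<le> s"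
      by (simp add: dist_norm norm_minus_commute)
    then have 1: "2 *\<^sub>R (y - real k *\<^sub>R u) \<in> f ` cball 0 1"
      using ball by (auto simp: subset_iff)
    have "4 * s * real k \<le> 4 * s * real K" using that s by simp
    then have "4 * s * real k \<le> norm (f e)" using e by linarith
    then have c: "4 * s * real k / norm (f e) \<le> 1" using fe0 by simp
    have "f ((4 * s * real k / norm (f e)) *\<^sub>R e) \<in> f ` cball 0 1"
      using c e s by (intro imageI) simp
    then have 2: "2 *\<^sub>R (real k *\<^sub>R u) \<in> f ` cball 0 1"
      by (simp add: linear_scale[OF f(1)] u_def mult_ac)
    have "(1/2) *\<^sub>R (2 *\<^sub>R (y - real k *\<^sub>R u)) + (1/2) *\<^sub>R (2 *\<^sub>R (real k *\<^sub>R u)) \<in> f ` cball 0 1"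
      using convexD[OF conv 1 2, of "1/2" "1/2"] by simp
    then show "y \<in> f ` cball 0 1" by simp
  qed
  have "(real K + 1) * (s / 2) ^ DIM(real^'n) * measure lebesgue (cball (0::real^'n) 1)
        \<le> measure lebesgue (f ` cball 0 1)"
    by (rule measure_ge_ball_progression[of _ u])
       (use nu s sub in \<open>auto intro: lmeasurable_linear_image f\<close>)
  then show ?thesis
    using measure_unit_cball_pos[where ?'a = "real^'n"] by (simp add: modulus_def field_simps)
qed

section \<open>Blichfeldt's theorem\<close>

text \<open>If no two points of \<open>S\<close> differ by a lattice vector then the translates of \<open>S\<close> by the points of
  an integral cube of side \<open>N\<close> are disjoint.  They fit into a cube of side \<open>N + 2 c\<close>, and comparing
  volumes for \<open>N \<rightarrow> \<infinity>\<close> bounds the volume of \<open>S\<close> by 1.\<close>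
lemma Blichfeldt:
  fixes S :: "(real^'n) set"
  assumes S: "S \<in> lmeasurable" "bounded S" "measure lebesgue S > 1"
  shows "\<exists>x\<in>S. \<exists>y\<in>S. x \<noteq> y \<and> x - y \<in> int_lattice"
proof (rule ccontr)
  assume neg: "\<not> ?thesis"
  obtain c0 where c0: "\<And>x. x \<in> S \<Longrightarrow> norm x \<le> c0"
    using S(2) by (auto simp: bounded_iff)
  define c where "c = max c0 1"
  have c: "c > 0" "\<And>x i. x \<in> S \<Longrightarrow> \<bar>x $ i\<bar> \<le> c"
    using c0 component_le_norm_cart order_trans unfolding c_def by (smt (verit))+
  have bound: "real N ^ CARD('n) * measure lebesgue S \<le> (real N + 2 * c) ^ CARD('n)" for N :: nat
  proof -
    define I where "I = {f :: 'n \<Rightarrow> nat. \<forall>i. f i < N}"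
    define t :: "('n \<Rightarrow> nat) \<Rightarrow> real^'n" where "t f = (\<chi> i. real (f i))" for f
    have I: "I = Pi\<^sub>E UNIV (\<lambda>_. {..<N})"
      by (auto simp: I_def)
    then have fin: "finite I" and cI: "card I = N ^ CARD('n)"
      by (auto simp: card_PiE intro: finite_PiE)
    have "(real N) ^ CARD('n) * measure lebesgue S = (\<Sum>f\<in>I. measure lebesgue ((+) (t f) ` S))"
      by (simp add: measure_translation cI)
    also have "\<dots> = measure lebesgue (\<Union>f\<in>I. (+) (t f) ` S)"
    proof (rule measure_negligible_finite_Union_image[symmetric])
      have "(+) (t f) ` S \<inter> (+) (t g) ` S = {}" if "f \<noteq> g" for f g
      proof (rule ccontr)
        assume "(+) (t f) ` S \<inter> (+) (t g) ` S \<noteq> {}"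
        then obtain x y where xy: "x \<in> S" "y \<in> S" "t f + x = t g + y" by auto
        then have d: "x - y = t g - t f" by (simp add: algebra_simps)
        have "x - y \<in> int_lattice"
          unfolding d by (simp add: int_lattice_def t_def)
        moreover have "x \<noteq> y"
          using that d by (auto simp: t_def vec_eq_iff)
        ultimately show False using neg xy by blast
      qed
      then show "pairwise (\<lambda>f g. negligible ((+) (t f) ` S \<inter> (+) (t g) ` S)) I"
        by (auto simp: pairwise_def)
      show "(+) (t f) ` S \<in> lmeasurable" for f
        using S(1) by (rule measurable_translation)
    qed (fact fin)
    also have "\<dots> \<le> measure lebesgue (cbox (\<chi> i. - c) (\<chi> i. real N + c) :: (real^'n) set)"
    proof (rule measure_mono_fmeasurable)
      show "(\<Union>f\<in>I. (+) (t f) ` S) \<subseteq> cbox (\<chi> i. - c) (\<chi> i. real N + c)"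
      proof clarsimp
        fix f x assume f: "f \<in> I" and x: "x \<in> S"
        have "- c \<le> real (f i) + x $ i \<and> real (f i) + x $ i \<le> real N + c" for i
          using c(2)[OF x, of i] f unfolding I_def by (auto simp: abs_le_iff) (smt (verit) less_imp_le of_nat_mono)
        then show "t f + x \<in> cbox (\<chi> i. - c) (\<chi> i. real N + c)"
          by (simp add: mem_box_cart t_def)
      qed
      show "(\<Union>f\<in>I. (+) (t f) ` S) \<in> sets lebesgue"
        using S(1) fin by (intro sets.finite_UN fmeasurableD measurable_translation) auto
    qed auto
    also have "\<dots> = (real N + 2 * c) ^ CARD('n)"
    proof -
      have "cbox (\<chi> i. - c) (\<chi> i. real N + c) \<noteq> ({} :: (real^'n) set)"
        using c(1) by (simp add: interval_ne_empty_cart)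
      then show ?thesis by (simp add: content_cbox_cart algebra_simps)
    qed
    finally show ?thesis .
  qed
  have "(\<lambda>N. (1 + 2 * c * inverse (real (Suc N))) ^ CARD('n)) \<longlonglongrightarrow> (1 + 2 * c * 0) ^ CARD('n)"
    by (intro tendsto_intros LIMSEQ_inverse_real_of_nat)
  moreover have "measure lebesgue S \<le> (1 + 2 * c * inverse (real (Suc N))) ^ CARD('n)" for N
  proof -
    have "(real (Suc N) + 2 * c) = real (Suc N) * (1 + 2 * c * inverse (real (Suc N)))"
      by (simp add: field_simps)
    then have "real (Suc N) ^ CARD('n) * measure lebesgue S
      \<le> real (Suc N) ^ CARD('n) * (1 + 2 * c * inverse (real (Suc N))) ^ CARD('n)"
      using bound[of "Suc N"] by (simp only: power_mult_distrib)
    then show ?thesis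
      by (subst (asm) mult_le_cancel_left_pos) auto
  qed
  ultimately have "measure lebesgue S \<le> 1"
    by (intro LIMSEQ_le_const[where X = "\<lambda>N. (1 + 2 * c * inverse (real (Suc N))) ^ CARD('n)"]) auto
  with S(3) show False by simp
qed

section \<open>The commutant of a transitive permutation group\<close>

definition zero_sum :: "(real^'n) set" where
  "zero_sum = {v. (\<Sum>i\<in>UNIV. v $ i) = 0}"

definition mean :: "real^'n \<Rightarrow> real" where
  "mean v = (\<Sum>i\<in>UNIV. v $ i) / real CARD('n)"

definition centred :: "real^'n \<Rightarrow> real^'n" where
  "centred v = v - vec (mean v)"

lemma centred_zero_sum: "centred v \<in> zero_sum"
  by (simp add: centred_def zero_sum_def mean_def sum_subtractf)

text \<open>The base point \<open>i0\<close> can be any of the permuted letters.  The rows and stabilizers below refer to it.\<close>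
locale transitive_action =
  fixes G :: "('n::finite \<Rightarrow> 'n) set" and i0 :: 'n
  assumes transitive: "transitive_group G"
begin

lemma subgroup_G: "subgroup G (BijGroup UNIV)"
  using transitive by (simp add: transitive_group_def permutation_group_def)

lemma bij_G: "g \<in> G \<Longrightarrow> bij g"
  using subgroup.subset[OF subgroup_G] by (auto simp: BijGroup_def Bij_def)

lemma id_G: "id \<in> G"
  using subgroup.one_closed[OF subgroup_G] by (simp add: BijGroup_def id_def restrict_def)

lemma comp_G:
  assumes "g \<in> G" "h \<in> G"
  shows "g \<circ> h \<in> G"
proof -
  have "g \<in> Bij UNIV" "h \<in> Bij UNIV"
    using subgroup.subset[OF subgroup_G] assms by (auto simp: BijGroup_def)
  then show ?thesis
    using subgroup.m_closed[OF subgroup_G assms]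
    by (simp add: BijGroup_def compose_def o_def restrict_def)
qed

lemma inv_G:
  assumes "g \<in> G"
  shows "inv_into UNIV g \<in> G"
proof -
  have "g \<in> Bij UNIV"
    using subgroup.subset[OF subgroup_G] assms by (auto simp: BijGroup_def)
  then show ?thesis
    using subgroup.m_inv_closed[OF subgroup_G assms]
    by (simp add: inv_BijGroup restrict_def)
qed

lemma inv_apply_G [simp]: "g \<in> G \<Longrightarrow> inv_into UNIV g (g i) = i" "g \<in> G \<Longrightarrow> g (inv_into UNIV g i) = i"
  using bij_G by (auto simp: bij_is_inj bij_is_surj surj_f_inv_f)

lemma inv_inv_G [simp]: "g \<in> G \<Longrightarrow> inv_into UNIV (inv_into UNIV g) = g"
  using bij_G by (simp add: inv_inv_eq)

lemma finite_G [simp]: "finite G"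
  by simp

lemma card_G_pos: "card G > 0"
  using id_G by (auto simp: card_gt_0_iff)

lemma move_to: obtains g where "g \<in> G" "g i = j"
  using transitive by (auto simp: transitive_group_def)

lemma sum_reindex_G: "g \<in> G \<Longrightarrow> (\<Sum>j\<in>UNIV. f (g j)) = (\<Sum>j\<in>UNIV. f j)"
  by (rule sum.reindex_bij_betw) (rule bij_G)

lemma sum_mult_right_G:
  assumes "h \<in> G"
  shows "(\<Sum>g\<in>G. f (g \<circ> h)) = (\<Sum>g\<in>G. f g)"
proof (rule sum.reindex_bij_witness[where j = "\<lambda>g. g \<circ> h" and i = "\<lambda>g. g \<circ> inv_into UNIV h"])
  show "g \<circ> inv_into UNIV h \<in> G" if "g \<in> G" for g
    using assms that comp_G inv_G by blast
qed (use assms comp_G in \<open>auto simp: fun_eq_iff\<close>)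

lemma perm_matrix_nth: "g \<in> G \<Longrightarrow> (perm_matrix g *v v) $ (g j) = v $ j"
proof -
  assume g: "g \<in> G"
  have "(\<Sum>k\<in>UNIV. (if g j = g k then 1 else 0) * v $ k) = (\<Sum>k\<in>UNIV. if k = j then v $ k else 0)"
    using bij_is_inj[OF bij_G[OF g]] by (intro sum.cong) (auto simp: inj_eq)
  then show ?thesis
    by (simp add: matrix_vector_mult_def perm_matrix_def)
qed

lemma perm_matrix_nth_inv: "g \<in> G \<Longrightarrow> (perm_matrix g *v v) $ i = v $ (inv_into UNIV g i)"
  using perm_matrix_nth[of g v "inv_into UNIV g i"] by simp

lemma perm_matrix_inner: "g \<in> G \<Longrightarrow> (perm_matrix g *v v) \<bullet> w = (\<Sum>j\<in>UNIV. v $ j * w $ (g j))"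
  using sum_reindex_G[of g "\<lambda>i. (perm_matrix g *v v) $ i * w $ i"]
  by (simp add: inner_vec_def perm_matrix_nth)

lemma Fix_iff: "v \<in> Fix G \<longleftrightarrow> (\<forall>i j. v $ i = v $ j)"
proof safe
  fix i j assume v: "v \<in> Fix G"
  obtain g where g: "g \<in> G" "g i = j" by (rule move_to)
  then have "perm_matrix g *v v = v" using v by (simp add: Fix_def)
  then show "v $ i = v $ j" using perm_matrix_nth[OF g(1), of v i] g(2) by simp
next
  assume "\<forall>i j. v $ i = v $ j"
  then show "v \<in> Fix G" by (simp add: Fix_def vec_eq_iff perm_matrix_nth_inv)
qed

lemma Fix_perp: "(Fix G)\<^sup>\<bottom> = zero_sum"
proof (rule Set.set_eqI)
  fix v
  have "vec 1 \<in> Fix G" by (simp add: Fix_iff)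
  then have "v \<in> (Fix G)\<^sup>\<bottom> \<Longrightarrow> v \<in> zero_sum"
    by (auto simp: orthogonal_comp_def orthogonal_def zero_sum_def inner_vec_def)
  moreover have "v \<in> (Fix G)\<^sup>\<bottom>" if "v \<in> zero_sum"
    unfolding orthogonal_comp_def
  proof clarsimp
    fix x assume "x \<in> Fix G"
    then have "x \<bullet> v = x $ i0 * (\<Sum>i\<in>UNIV. v $ i)"
      by (auto simp: inner_vec_def sum_distrib_left Fix_iff intro!: sum.cong)
    then show "orthogonal x v" using that by (simp add: orthogonal_def zero_sum_def)
  qed
  ultimately show "v \<in> (Fix G)\<^sup>\<bottom> \<longleftrightarrow> v \<in> zero_sum" by blast
qed

lemma subspace_zero_sum: "subspace (zero_sum :: (real^'n) set)"
  using subspace_orthogonal_comp[of "Fix G"] by (simp only: Fix_perp)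

text \<open>The algebra of operators that commute with the group and vanish on the all-one vector.  For a
  matrix, commuting with permutation matrices means that its entries are constant on the orbits of
  pairs of indices.  This algebra acts on the vectors of zero sum and has its own unit, the
  projection \<open>centring\<close> introduced later.\<close>
definition commutant0 :: "(real^'n^'n) set" where
  "commutant0 = {A. (\<forall>g\<in>G. \<forall>i j. A $ g i $ g j = A $ i $ j) \<and> (\<forall>i. (\<Sum>j\<in>UNIV. A $ i $ j) = 0)}"

lemma commutant0D:
  assumes "A \<in> commutant0"
  shows "g \<in> G \<Longrightarrow> A $ g i $ g j = A $ i $ j" "(\<Sum>j\<in>UNIV. A $ i $ j) = 0"
  using assms by (auto simp: commutant0_def)

text \<open>All column sums agree by transitivity, and their total is the total of the row sums.\<close>
lemma commutant0_column_sum: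
  assumes A: "A \<in> commutant0"
  shows "(\<Sum>i\<in>UNIV. A $ i $ j) = 0"
proof -
  have const: "(\<Sum>i\<in>UNIV. A $ i $ k) = (\<Sum>i\<in>UNIV. A $ i $ j)" for k
  proof -
    obtain g where g: "g \<in> G" "g j = k" by (rule move_to)
    have "(\<Sum>i\<in>UNIV. A $ i $ k) = (\<Sum>i\<in>UNIV. A $ g i $ g j)"
      using sum_reindex_G[OF g(1), of "\<lambda>i. A $ i $ k"] g(2) by simp
    then show ?thesis using commutant0D(1)[OF A g(1)] by simp
  qed
  have "real CARD('n) * (\<Sum>i\<in>UNIV. A $ i $ j) = (\<Sum>k\<in>(UNIV::'n set). \<Sum>i\<in>UNIV. A $ i $ j)"
    by simp
  also have "\<dots> = (\<Sum>k\<in>UNIV. \<Sum>i\<in>UNIV. A $ i $ k)"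
    by (intro sum.cong refl const[symmetric])
  also have "\<dots> = (\<Sum>i\<in>UNIV. \<Sum>k\<in>UNIV. A $ i $ k)" by (rule sum.swap)
  also have "\<dots> = 0" using commutant0D(2)[OF A] by simp
  finally show ?thesis by simp
qed

lemma commutant0I:
  assumes "\<And>g i j. g \<in> G \<Longrightarrow> A $ g i $ g j = A $ i $ j" "\<And>i. (\<Sum>j\<in>UNIV. A $ i $ j) = 0"
  shows "A \<in> commutant0"
  using assms by (simp add: commutant0_def)

lemma commutant0_transpose:
  assumes "A \<in> commutant0"
  shows "transpose A \<in> commutant0"
  by (rule commutant0I)
     (simp_all add: transpose_def commutant0D(1)[OF assms] commutant0_column_sum[OF assms])

lemma commutant0_mult:
  assumes "A \<in> commutant0" "B \<in> commutant0"
  shows "A ** B \<in> commutant0"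
proof -
  have "(A ** B) $ g i $ g j = (A ** B) $ i $ j" if "g \<in> G" for g i j
    using sum_reindex_G[OF that, of "\<lambda>k. A $ g i $ k * B $ k $ g j"] assms that
    by (simp add: matrix_matrix_mult_def commutant0D)
  moreover have "(\<Sum>j\<in>UNIV. (A ** B) $ i $ j) = 0" for i
  proof -
    have "(\<Sum>j\<in>UNIV. (A ** B) $ i $ j) = (\<Sum>k\<in>UNIV. A $ i $ k * (\<Sum>j\<in>UNIV. B $ k $ j))"
      unfolding sum_distrib_left by (subst sum.swap) (simp add: matrix_matrix_mult_def)
    then show ?thesis using assms by (simp add: commutant0D)
  qed
  ultimately show ?thesis by (rule commutant0I)
qed

lemma commutant0_add: "A \<in> commutant0 \<Longrightarrow> B \<in> commutant0 \<Longrightarrow> A + B \<in> commutant0"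
  and commutant0_diff: "A \<in> commutant0 \<Longrightarrow> B \<in> commutant0 \<Longrightarrow> A - B \<in> commutant0"
  and commutant0_scaleR: "A \<in> commutant0 \<Longrightarrow> c *\<^sub>R A \<in> commutant0"
  by (auto simp: commutant0_def sum.distrib sum_subtractf sum_distrib_left[symmetric])

lemma commutant0_range: "A \<in> commutant0 \<Longrightarrow> A *v v \<in> zero_sum"
proof -
  assume A: "A \<in> commutant0"
  have "(\<Sum>i\<in>UNIV. (A *v v) $ i) = (\<Sum>i\<in>UNIV. \<Sum>j\<in>UNIV. A $ i $ j * v $ j)"
    by (simp add: matrix_vector_mult_def)
  also have "\<dots> = (\<Sum>j\<in>UNIV. \<Sum>i\<in>UNIV. A $ i $ j * v $ j)"
    by (rule sum.swap)
  also have "\<dots> = (\<Sum>j\<in>UNIV. (\<Sum>i\<in>UNIV. A $ i $ j) * v $ j)"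
    by (simp only: sum_distrib_right)
  finally have "(\<Sum>i\<in>UNIV. (A *v v) $ i) = (\<Sum>j\<in>UNIV. (\<Sum>i\<in>UNIV. A $ i $ j) * v $ j)" .
  then show ?thesis using commutant0_column_sum[OF A] by (simp add: zero_sum_def)
qed

lemma commutant0_const: "A \<in> commutant0 \<Longrightarrow> A *v vec c = 0"
  using commutant0D(2)[of A] by (simp add: matrix_vector_mult_def vec_eq_iff sum_distrib_right[symmetric])

lemma commutant0_perm:
  assumes "A \<in> commutant0" "g \<in> G"
  shows "perm_matrix g *v (A *v v) = A *v (perm_matrix g *v v)"
proof (rule vec_eq_iff[THEN iffD2, rule_format])
  fix i
  have "(A *v (perm_matrix g *v v)) $ (g (inv_into UNIV g i)) = (\<Sum>j\<in>UNIV. A $ g (inv_into UNIV g i) $ j * (perm_matrix g *v v) $ j)"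
    by (simp only: matrix_vector_mult_def vec_lambda_beta)
  also have "\<dots> = (\<Sum>j\<in>UNIV. A $ g (inv_into UNIV g i) $ g j * (perm_matrix g *v v) $ g j)"
    by (rule sum_reindex_G[OF assms(2), symmetric])
  also have "\<dots> = (A *v v) $ inv_into UNIV g i"
    by (simp only: commutant0D(1)[OF assms] perm_matrix_nth[OF assms(2)])
       (simp add: matrix_vector_mult_def)
  finally show "(perm_matrix g *v (A *v v)) $ i = (A *v (perm_matrix g *v v)) $ i"
    using assms(2) by (simp add: perm_matrix_nth_inv)
qed

lemma commutant0_centred: "A \<in> commutant0 \<Longrightarrow> A *v centred v = A *v v"
  by (simp add: centred_def matrix_vector_mult_diff_distrib commutant0_const)

text \<open>Here the QI property enters.  The range of a rational matrix is spanned by its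
  columns, hence rational; it is invariant and nonzero, so it is all of \<open>zero_sum\<close>.  A surjective
  operator on this space is injective.\<close>
lemma commutant0_injective:
  assumes QI: "QI_group G" and A: "A \<in> commutant0" "\<And>i j. A $ i $ j \<in> \<rat>" "A \<noteq> 0"
    and v: "v \<in> zero_sum" "A *v v = 0"
  shows "v = 0"
proof -
  define V where "V = span (columns A)"
  have ran: "V = range ((*v) A)"
  proof
    show "range ((*v) A) \<subseteq> V"
      unfolding V_def by (auto simp: matrix_vector_mult_in_columnspace)
    have "columns A \<subseteq> range ((*v) A)"
      by (auto simp: columns_def matrix_vector_mult_basis[symmetric])
    then show "V \<subseteq> range ((*v) A)"
      unfolding V_def by (intro span_minimal linear_subspace_image) auto
  qed
  obtain B where B: "B \<subseteq> columns A" "independent B" "columns A \<subseteq> span B"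
    using maximal_independent_subset by blast
  have "span B = V"
    unfolding V_def by (meson B span_minimal span_mono subset_antisym subspace_span)
  moreover have "\<forall>b\<in>B. \<forall>i. b $ i \<in> \<rat>"
    using B(1) A(2) by (auto simp: columns_def column_def)
  ultimately have "rational_subspace V"
    using B(2) by (auto simp: rational_subspace_def)
  moreover have "invariant_under G V"
    using commutant0_perm[OF A(1)] by (auto simp: invariant_under_def ran)
  moreover have "V \<subseteq> (Fix G)\<^sup>\<bottom>"
    using commutant0_range[OF A(1)] by (auto simp: ran Fix_perp)
  moreover have "V \<noteq> {0}"
  proof
    assume "V = {0}"
    then have "A *v x = 0" for x using ran by auto
    then have "A = 0" by (simp add: matrix_eq)
    with A(3) show False by simp
  qed
  ultimately have V: "V = zero_sum"
    using QI by (auto simp: QI_group_def Fix_perp)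
  (* Acting by the mean on constant vectors turns A into an operator on the whole space. *)
  define f where "f x = A *v x + vec (mean x)" for x
  have lin: "linear f"
    by (rule linearI) (auto simp: f_def mean_def matrix_vector_right_distrib sum.distrib vec_eq_iff
        add_divide_distrib algebra_simps matrix_vector_mult_scaleR sum_distrib_left[symmetric])
  have "surj f"
    unfolding surj_def
  proof
    fix y
    have "centred y \<in> range ((*v) A)"
      using V ran centred_zero_sum by auto
    then obtain x where x: "A *v x = centred y" by auto
    have "mean (centred x + vec (mean y)) = mean y"
      using centred_zero_sum[of x] by (simp add: mean_def zero_sum_def sum.distrib)
    then have "f (centred x + vec (mean y)) = A *v centred x + vec (mean y)"
      by (simp add: f_def matrix_vector_right_distrib commutant0_const[OF A(1)])
    also have "\<dots> = y"
      unfolding commutant0_centred[OF A(1)] x by (simp add: centred_def)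
    finally show "\<exists>x. y = f x" by metis
  qed
  then have "inj f"
    using lin linear_surjective_imp_injective by blast
  moreover have "f v = f 0"
    using v by (simp add: f_def mean_def zero_sum_def)
  ultimately show "v = 0" by (simp add: inj_eq)
qed

lemma commutant0_no_zero_divisors:
  assumes "QI_group G" "A \<in> commutant0" "\<And>i j. A $ i $ j \<in> \<rat>" "A \<noteq> 0"
    and B: "B \<in> commutant0" "A ** B = 0"
  shows "B = 0"
proof -
  have "B *v v = 0" for v
  proof (rule commutant0_injective[OF assms(1-4)])
    show "B *v v \<in> zero_sum" using B commutant0_range by blast
    show "A *v (B *v v) = 0" using B(2) by (simp add: matrix_vector_mul_assoc)
  qed
  then show ?thesis by (simp add: matrix_eq)
qed

end

section \<open>Integral matrices and vectors fixed by a point stabilizer\<close>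

definition int_matrix :: "real^'n^'m \<Rightarrow> bool" where
  "int_matrix A \<longleftrightarrow> (\<forall>i j. A $ i $ j \<in> \<int>)"

lemma int_matrix_mult: "int_matrix A \<Longrightarrow> int_matrix B \<Longrightarrow> int_matrix (A ** B)"
  by (auto simp: int_matrix_def matrix_matrix_mult_def intro!: Ints_sum Ints_mult)

lemma int_matrix_vec: "int_matrix A \<Longrightarrow> v \<in> int_lattice \<Longrightarrow> A *v v \<in> int_lattice"
  by (auto simp: int_matrix_def int_lattice_def matrix_vector_mult_def intro!: Ints_sum Ints_mult)

lemma int_matrix_transpose: "int_matrix A \<Longrightarrow> int_matrix (transpose A)"
  by (simp add: int_matrix_def transpose_def)

lemma int_lattice_add: "v \<in> int_lattice \<Longrightarrow> w \<in> int_lattice \<Longrightarrow> v + w \<in> int_lattice"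
  and int_lattice_diff: "v \<in> int_lattice \<Longrightarrow> w \<in> int_lattice \<Longrightarrow> v - w \<in> int_lattice"
  and int_lattice_scale: "c \<in> \<int> \<Longrightarrow> v \<in> int_lattice \<Longrightarrow> c *\<^sub>R v \<in> int_lattice"
  by (auto simp: int_lattice_def)

lemma int_lattice_eq_0:
  assumes "v \<in> int_lattice" "norm v < 1"
  shows "v = 0"
proof -
  have "v $ i = 0" for i
  proof -
    have "\<bar>v $ i\<bar> < 1" using component_le_norm_cart[of v i] assms(2) by linarith
    moreover have "v $ i \<in> \<int>" using assms(1) by (simp add: int_lattice_def)
    ultimately show ?thesis using Ints_nonzero_abs_less1 by blast
  qed
  then show ?thesis by (simp add: vec_eq_iff)
qed

context transitive_action
begin

definition stab :: "('n \<Rightarrow> 'n) set" where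
  "stab = {h \<in> G. h i0 = i0}"

definition stab_fixed :: "(real^'n) set" where
  "stab_fixed = {p \<in> zero_sum. \<forall>h\<in>stab. \<forall>j. p $ h j = p $ j}"

text \<open>The average over the stabilizer with the mean removed: the orthogonal projection onto
  \<open>stab_fixed\<close>.\<close>
definition proj :: "real^'n \<Rightarrow> real^'n" where
  "proj p = (\<chi> j. (\<Sum>h\<in>stab. p $ h j) / real (card stab) - mean p)"

lemma stab_G: "h \<in> stab \<Longrightarrow> h \<in> G"
  by (simp add: stab_def)

lemma card_stab: "real (card stab) > 0"
proof -
  have "id \<in> stab" by (simp add: stab_def id_G)
  then show ?thesis by (auto simp: card_gt_0_iff)
qed

lemma stab_nonempty [simp]: "stab \<noteq> {}"
  using card_stab by auto

lemma comp_stab: "g \<in> stab \<Longrightarrow> h \<in> stab \<Longrightarrow> g \<circ> h \<in> stab"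
  by (simp add: stab_def comp_G)

lemma inv_stab: "h \<in> stab \<Longrightarrow> inv_into UNIV h \<in> stab"
proof -
  assume "h \<in> stab"
  then have h: "h \<in> G" "h i0 = i0" by (auto simp: stab_def)
  then have "inv_into UNIV h i0 = i0" using inv_apply_G(1)[OF h(1), of i0] by simp
  with h(1) show ?thesis by (simp add: stab_def inv_G)
qed

lemma sum_reindex_stab:
  assumes "h \<in> stab"
  shows "(\<Sum>g\<in>stab. f (g \<circ> h)) = (\<Sum>g\<in>stab. f g)"
proof (rule sum.reindex_bij_witness[where j = "\<lambda>g. g \<circ> h" and i = "\<lambda>g. g \<circ> inv_into UNIV h"])
  show "g \<circ> inv_into UNIV h \<in> stab" if "g \<in> stab" for g
    using assms that comp_stab inv_stab by blast
qed (use assms comp_stab stab_G in \<open>auto simp: fun_eq_iff\<close>)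

lemma sum_inv_stab: "(\<Sum>g\<in>stab. f (inv_into UNIV g)) = (\<Sum>g\<in>stab. f g)"
  by (rule sum.reindex_bij_witness[where j = "inv_into UNIV" and i = "inv_into UNIV"])
     (use inv_stab stab_G in auto)

lemma stab_fixed_zero_sum: "p \<in> stab_fixed \<Longrightarrow> p \<in> zero_sum"
  by (simp add: stab_fixed_def)

lemma linear_proj: "linear proj"
  by (rule linearI)
     (simp_all add: proj_def mean_def vec_eq_iff sum.distrib add_divide_distrib
        sum_distrib_left[symmetric] right_diff_distrib)

lemma proj_stab_fixed: "proj p \<in> stab_fixed"
proof -
  have "(\<Sum>j\<in>UNIV. \<Sum>h\<in>stab. p $ h j) = (\<Sum>h\<in>stab. \<Sum>j\<in>UNIV. p $ h j)"
    by (rule sum.swap)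
  also have "\<dots> = (\<Sum>h\<in>stab. \<Sum>j\<in>UNIV. p $ j)"
    by (intro sum.cong refl sum_reindex_G stab_G)
  finally have "(\<Sum>j\<in>UNIV. \<Sum>h\<in>stab. p $ h j) = real (card stab) * (\<Sum>j\<in>UNIV. p $ j)"
    by simp
  then have "proj p \<in> zero_sum"
    using card_stab by (simp add: zero_sum_def proj_def sum_subtractf sum_divide_distrib[symmetric] mean_def)
  moreover have "proj p $ h j = proj p $ j" if "h \<in> stab" for h j
    using sum_reindex_stab[OF that, of "\<lambda>g. p $ g j"] by (simp add: proj_def)
  ultimately show ?thesis by (simp add: stab_fixed_def)
qed

lemma proj_id: "p \<in> stab_fixed \<Longrightarrow> proj p = p"
  using card_stab by (simp add: stab_fixed_def zero_sum_def proj_def mean_def vec_eq_iff)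

lemma proj_inner: "proj p \<bullet> q = p \<bullet> proj q"
proof -
  have mean: "(\<Sum>j\<in>UNIV. mean p * q $ j) = (\<Sum>j\<in>UNIV. p $ j * mean q)"
    by (simp only: mean_def sum_distrib_left[symmetric] sum_distrib_right[symmetric]) simp
  have "(\<Sum>j\<in>UNIV. (\<Sum>h\<in>stab. p $ h j) * q $ j) = (\<Sum>h\<in>stab. \<Sum>j\<in>UNIV. p $ h j * q $ j)"
    by (simp only: sum_distrib_right sum.swap[of _ UNIV stab])
  also have "\<dots> = (\<Sum>h\<in>stab. \<Sum>j\<in>UNIV. p $ j * q $ inv_into UNIV h j)"
  proof (rule sum.cong[OF refl])
    fix h assume "h \<in> stab"
    then have h: "h \<in> G" by (rule stab_G)
    show "(\<Sum>j\<in>UNIV. p $ h j * q $ j) = (\<Sum>j\<in>UNIV. p $ j * q $ inv_into UNIV h j)"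
      using sum_reindex_G[OF h, of "\<lambda>j. p $ j * q $ inv_into UNIV h j"] h by simp
  qed
  also have "\<dots> = (\<Sum>h\<in>stab. \<Sum>j\<in>UNIV. p $ j * q $ h j)"
    by (rule sum_inv_stab)
  also have "\<dots> = (\<Sum>j\<in>UNIV. p $ j * (\<Sum>h\<in>stab. q $ h j))"
    by (simp only: sum_distrib_left sum.swap[of _ UNIV stab])
  finally have "(\<Sum>j\<in>UNIV. (\<Sum>h\<in>stab. p $ h j) / card stab * q $ j) =
                (\<Sum>j\<in>UNIV. p $ j * ((\<Sum>h\<in>stab. q $ h j) / card stab))"
    by (simp add: sum_divide_distrib[symmetric])
  with mean show ?thesis
    by (simp add: inner_vec_def proj_def left_diff_distrib right_diff_distrib sum_subtractf)
qed

lemma proj_orthogonal: "proj p \<bullet> (q - proj q) = 0"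
  using proj_inner[of "proj p" q] proj_inner[of p q]
  by (simp add: inner_diff_right proj_id proj_stab_fixed)

lemma norm_proj_Pythagoras: "(norm p)\<^sup>2 = (norm (proj p))\<^sup>2 + (norm (p - proj p))\<^sup>2"
proof -
  have "(norm (proj p + (p - proj p)))\<^sup>2 = (norm (proj p))\<^sup>2 + (norm (p - proj p))\<^sup>2"
    by (rule norm_add_Pythagorean) (simp add: orthogonal_def proj_orthogonal)
  then show ?thesis by simp
qed

lemma norm_proj_le: "norm (proj p) \<le> norm p" and norm_diff_proj_le: "norm (p - proj p) \<le> norm p"
proof -
  have "(norm (proj p))\<^sup>2 \<le> (norm p)\<^sup>2" "(norm (p - proj p))\<^sup>2 \<le> (norm p)\<^sup>2"
    using norm_proj_Pythagoras[of p] zero_le_power2[of "norm (proj p)"]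
      zero_le_power2[of "norm (p - proj p)"] by linarith+
  then show "norm (proj p) \<le> norm p" "norm (p - proj p) \<le> norm p"
    using power2_le_imp_le norm_ge_zero by blast+
qed

lemma commutant0_proj:
  assumes A: "A \<in> commutant0"
  shows "proj (A *v p) = A *v proj p"
proof (rule vec_eq_iff[THEN iffD2, rule_format])
  fix j
  have "(\<Sum>h\<in>stab. (A *v p) $ h j) = (\<Sum>h\<in>stab. \<Sum>k\<in>UNIV. A $ j $ k * p $ h k)"
  proof (rule sum.cong[OF refl])
    fix h assume "h \<in> stab"
    then have h: "h \<in> G" by (rule stab_G)
    show "(A *v p) $ h j = (\<Sum>k\<in>UNIV. A $ j $ k * p $ h k)"
      using sum_reindex_G[OF h, of "\<lambda>k. A $ h j $ k * p $ k"]
      by (simp add: matrix_vector_mult_def commutant0D(1)[OF A h])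
  qed
  also have "\<dots> = (\<Sum>k\<in>UNIV. A $ j $ k * (\<Sum>h\<in>stab. p $ h k))"
    by (simp only: sum_distrib_left sum.swap[of _ UNIV stab])
  finally have 1: "(\<Sum>h\<in>stab. (A *v p) $ h j) = (\<Sum>k\<in>UNIV. A $ j $ k * (\<Sum>h\<in>stab. p $ h k))" .
  have 2: "mean (A *v p) = 0"
    using commutant0_range[OF A, of p] by (simp add: zero_sum_def mean_def)
  have 3: "(\<Sum>k\<in>UNIV. A $ j $ k * mean p) = 0"
    using commutant0D(2)[OF A, of j] by (simp add: sum_distrib_right[symmetric])
  show "proj (A *v p) $ j = (A *v proj p) $ j"
    using 2 3
    by (simp add: 1 proj_def matrix_vector_mult_def[of A "\<chi> j. _ j"] right_diff_distrib
        sum_subtractf sum_divide_distrib[symmetric] sum_distrib_left[symmetric])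
qed

text \<open>The lattice need not be the direct sum of its intersections with \<open>stab_fixed\<close> and with
  the orthogonal complement, but the projection has a bounded denominator, so an integral
  vector which is close enough to \<open>stab_fixed\<close> lies in it.\<close>
lemma proj_denominator:
  assumes p: "p \<in> int_lattice"
  shows "(real (card stab) * real CARD('n)) *\<^sub>R (p - proj p) \<in> int_lattice"
proof -
  have "(real (card stab) * real CARD('n)) *\<^sub>R (p - proj p) $ j \<in> \<int>" for j
  proof -
    have "(real (card stab) * real CARD('n)) *\<^sub>R (p - proj p) $ j =
      real (card stab) * real CARD('n) * p $ j - real CARD('n) * (\<Sum>h\<in>stab. p $ h j)
       + real (card stab) * (\<Sum>i\<in>UNIV. p $ i)"
      using card_stab by (simp add: proj_def mean_def field_simps)
    also have "\<dots> \<in> \<int>"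
      using p by (intro Ints_add Ints_diff Ints_mult Ints_sum) (auto simp: int_lattice_def)
    finally show ?thesis .
  qed
  then show ?thesis by (simp add: int_lattice_def)
qed

lemma int_lattice_near_proj:
  assumes "p \<in> int_lattice" "norm (p - proj p) < 1 / (real (card stab) * real CARD('n))"
  shows "proj p = p"
proof -
  have "norm ((real (card stab) * real CARD('n)) *\<^sub>R (p - proj p)) < 1"
    using assms(2) card_stab by (simp only: norm_scaleR) (simp add: field_simps)
  then have "(real (card stab) * real CARD('n)) *\<^sub>R (p - proj p) = 0"
    using int_lattice_eq_0[OF proj_denominator[OF assms(1)]] by blast
  then show ?thesis using card_stab by simp
qed

text \<open>A choice of coset representatives of the stabilizer.\<close>
definition from_base :: "'n \<Rightarrow> 'n \<Rightarrow> 'n" where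
  "from_base i = (SOME g. g \<in> G \<and> g i0 = i)"

lemma from_base: "from_base i \<in> G" "from_base i i0 = i"
proof -
  have "\<exists>g. g \<in> G \<and> g i0 = i" using move_to by metis
  then have "from_base i \<in> G \<and> from_base i i0 = i" unfolding from_base_def by (rule someI_ex)
  then show "from_base i \<in> G" "from_base i i0 = i" by auto
qed

text \<open>The inverse of the map that sends an element of \<open>commutant0\<close> to its row at the base point.\<close>
definition of_row :: "real^'n \<Rightarrow> real^'n^'n" where
  "of_row p = (\<chi> i j. p $ inv_into UNIV (from_base i) j)"

lemma of_row_nth:
  assumes p: "p \<in> stab_fixed" and g: "g \<in> G"
  shows "of_row p $ g i0 $ g j = p $ j"
proof -
  define f where "f = from_base (g i0)"
  have f: "f \<in> G" "f i0 = g i0" by (auto simp: f_def from_base)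
  have "inv_into UNIV f \<circ> g \<in> stab"
    using f g inv_apply_G(1)[OF f(1), of i0] by (simp add: stab_def comp_G inv_G)
  then have "p $ (inv_into UNIV f \<circ> g) j = p $ j"
    using p by (auto simp: stab_fixed_def)
  then show ?thesis by (simp add: of_row_def f_def)
qed

lemma of_row_commutant0: "p \<in> stab_fixed \<Longrightarrow> of_row p \<in> commutant0"
proof (rule commutant0I)
  assume p: "p \<in> stab_fixed"
  fix g i j assume g: "g \<in> G"
  define f where "f = from_base i"
  have f: "f \<in> G" "f i0 = i" by (auto simp: f_def from_base)
  have "of_row p $ (g \<circ> f) i0 $ (g \<circ> f) (inv_into UNIV f j) = of_row p $ f i0 $ f (inv_into UNIV f j)"
    unfolding of_row_nth[OF p comp_G[OF g f(1)]] of_row_nth[OF p f(1)] ..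
  then show "of_row p $ g i $ g j = of_row p $ i $ j" using f by simp
next
  assume p: "p \<in> stab_fixed"
  fix i
  have "inv_into UNIV (from_base i) \<in> G" by (simp add: from_base inv_G)
  from sum_reindex_G[OF this, of "\<lambda>j. p $ j"] show "(\<Sum>j\<in>UNIV. of_row p $ i $ j) = 0"
    using p by (simp add: of_row_def stab_fixed_def zero_sum_def)
qed

lemma of_row_row: "p \<in> stab_fixed \<Longrightarrow> of_row p $ i0 = p"
  using of_row_nth[OF _ id_G] by (simp add: vec_eq_iff)

lemma commutant0_row_stab_fixed: "A \<in> commutant0 \<Longrightarrow> A $ i0 \<in> stab_fixed"
proof -
  assume A: "A \<in> commutant0"
  have "A $ i0 $ h j = A $ i0 $ j" if "h \<in> stab" for h j
    using commutant0D(1)[OF A, of h i0 j] that by (simp add: stab_def)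
  then show ?thesis using commutant0D(2)[OF A] by (simp add: stab_fixed_def zero_sum_def)
qed

lemma commutant0_eqI:
  assumes "A \<in> commutant0" "B \<in> commutant0" "A $ i0 = B $ i0"
  shows "A = B"
proof -
  have "A $ i $ j = B $ i $ j" for i j
  proof -
    define f where "f = from_base i"
    have f: "f \<in> G" "f i0 = i" by (auto simp: f_def from_base)
    have "A $ f i0 $ f (inv_into UNIV f j) = B $ f i0 $ f (inv_into UNIV f j)"
      by (simp only: commutant0D(1)[OF assms(1) f(1)] commutant0D(1)[OF assms(2) f(1)] assms(3))
    then show ?thesis using f by simp
  qed
  then show ?thesis by (simp add: vec_eq_iff)
qed

lemma matrix_mult_row: "((A :: real^'n^'n) ** B) $ i = transpose B *v (A $ i)"
  by (simp add: matrix_matrix_mult_def matrix_vector_mult_def transpose_def vec_eq_iff mult.commute[of "A $ i $ _"])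

lemma of_row_int: "p \<in> int_lattice \<Longrightarrow> int_matrix (of_row p)"
  by (simp add: of_row_def int_lattice_def int_matrix_def)

lemma norm_of_row_row: "norm (of_row p $ i) = norm p"
proof -
  have g: "inv_into UNIV (from_base i) \<in> G" by (simp add: from_base inv_G)
  show ?thesis
    using sum_reindex_G[OF g, of "\<lambda>j. (p $ j)\<^sup>2"]
    by (simp add: norm_vec_def L2_set_def of_row_def)
qed

lemma norm_of_row_mult: "norm (of_row p *v v) \<le> real CARD('n) * norm p * norm v"
proof -
  have "norm (of_row p *v v) \<le> (\<Sum>i\<in>UNIV. \<bar>(of_row p *v v) $ i\<bar>)"
    by (rule norm_le_l1_cart)
  also have "\<dots> \<le> (\<Sum>i\<in>(UNIV::'n set). norm p * norm v)"
  proof (rule sum_mono)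
    fix i
    have "\<bar>(of_row p *v v) $ i\<bar> = \<bar>of_row p $ i \<bullet> v\<bar>"
      by (simp add: matrix_vector_mul_component)
    also have "\<dots> \<le> norm (of_row p $ i) * norm v" by (rule Cauchy_Schwarz_ineq2)
    finally show "\<bar>(of_row p *v v) $ i\<bar> \<le> norm p * norm v" by (simp add: norm_of_row_row)
  qed
  finally show ?thesis by simp
qed

text \<open>The bound for a matrix passes to its transpose since both have the same operator norm.\<close>
lemma norm_transpose_of_row_mult: "norm (transpose (of_row p) *v v) \<le> real CARD('n) * norm p * norm v"
proof -
  have "(norm (transpose (of_row p) *v v))\<^sup>2 = v \<bullet> (of_row p *v (transpose (of_row p) *v v))"
    unfolding power2_norm_eq_inner by (simp only: transpose_matrix_vector dot_lmul_matrix)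
  also have "\<dots> \<le> norm v * norm (of_row p *v (transpose (of_row p) *v v))"
    by (rule norm_cauchy_schwarz)
  also have "\<dots> \<le> norm v * (real CARD('n) * norm p * norm (transpose (of_row p) *v v))"
    by (intro mult_left_mono norm_of_row_mult) auto
  finally have "norm (transpose (of_row p) *v v) * norm (transpose (of_row p) *v v)
      \<le> (real CARD('n) * norm p * norm v) * norm (transpose (of_row p) *v v)"
    by (simp add: power2_eq_square mult_ac)
  then show ?thesis
    by (cases "norm (transpose (of_row p) *v v) = 0") (simp_all add: mult_le_cancel_right)
qed

end

section \<open>Integral elements of the commutant\<close>

text \<open>Dividing by \<open>b\<close> until the value would drop to 1 or below stops in the interval from 1 to \<open>b\<close>.\<close>
lemma exists_normalising_power:
  fixes b x :: real
  assumes "b > 1" "x > 1"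
  shows "\<exists>k. 1 < x / b ^ k \<and> x / b ^ k \<le> b"
proof -
  define m where "m = (LEAST m. x \<le> b ^ m)"
  have "\<exists>m. x \<le> b ^ m"
    using real_arch_pow[OF assms(1), of x] by (auto intro: less_imp_le)
  then have m: "x \<le> b ^ m" unfolding m_def by (rule LeastI_ex)
  then have "m \<noteq> 0" using assms(2) by (intro notI) simp
  then obtain k where k: "m = Suc k" by (cases m) auto
  then have "k < m" by simp
  then have "\<not> x \<le> b ^ k" unfolding m_def by (rule not_less_Least)
  moreover have "b ^ k > 0" using assms(1) by simp
  ultimately have "1 < x / b ^ k \<and> x / b ^ k \<le> b"
    using m k by (simp add: field_simps)
  then show ?thesis by blast
qed

context transitive_action
begin

text \<open>The operator \<open>A\<close> on \<open>stab_fixed\<close>, extended by the identity on the orthogonal complement.  This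
  extension makes it an operator on a full coordinate space, where volumes and lattices are
  available, while its modulus is that of \<open>A\<close> on \<open>stab_fixed\<close>.\<close>
definition twist :: "real^'n^'n \<Rightarrow> real^'n \<Rightarrow> real^'n" where
  "twist A p = A *v proj p + (p - proj p)"

text \<open>The orthogonal projection onto the vectors of zero sum, which is the unit of \<open>commutant0\<close>.\<close>
definition centring :: "real^'n^'n" where
  "centring = (\<chi> i j. (if i = j then 1 else 0) - 1 / real CARD('n))"

lemma centring_commutant0: "centring \<in> commutant0"
proof (rule commutant0I)
  show "centring $ g i $ g j = centring $ i $ j" if "g \<in> G" for g i j
    using bij_is_inj[OF bij_G[OF that]] by (simp add: centring_def inj_eq)
  show "(\<Sum>j\<in>UNIV. centring $ i $ j) = 0" for i
    by (simp add: centring_def sum_subtractf)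
qed

lemma centring_vec: "centring *v v = centred v"
proof -
  have "(\<Sum>j\<in>UNIV. ((if i = j then 1 else 0) - 1 / real CARD('n)) * v $ j) = v $ i - mean v" for i
  proof -
    have "(\<Sum>j\<in>UNIV. ((if i = j then 1 else 0) - 1 / real CARD('n)) * v $ j)
      = (\<Sum>j\<in>UNIV. (if i = j then v $ j else 0) - v $ j / real CARD('n))"
      by (intro sum.cong) (auto simp: algebra_simps)
    then show ?thesis by (simp add: sum_subtractf mean_def sum_divide_distrib)
  qed
  then show ?thesis by (simp add: vec_eq_iff centring_def matrix_vector_mult_def centred_def)
qed

lemma centred_id: "v \<in> zero_sum \<Longrightarrow> centred v = v"
  by (simp add: centred_def zero_sum_def mean_def vec_eq_iff)

lemma centring_unit: "A \<in> commutant0 \<Longrightarrow> A ** centring = A" "A \<in> commutant0 \<Longrightarrow> centring ** A = A"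
  by (simp_all add: matrix_eq centring_vec commutant0_centred centred_id commutant0_range
      flip: matrix_vector_mul_assoc)

lemma zero_sum_proj: "proj p \<in> zero_sum"
  using proj_stab_fixed stab_fixed_zero_sum by blast

lemma linear_twist: "linear (twist A)"
  unfolding twist_def
  by (intro linear_compose_add linear_compose_sub linear_proj linear_ident
      linear_compose[OF linear_proj, of "(*v) A", unfolded o_def]) auto

lemma proj_twist: "A \<in> commutant0 \<Longrightarrow> proj (twist A p) = A *v proj p"
  by (simp add: twist_def linear_add[OF linear_proj] linear_diff[OF linear_proj]
      commutant0_proj proj_id proj_stab_fixed)

lemma twist_comp: "B \<in> commutant0 \<Longrightarrow> twist A (twist B p) = twist (A ** B) p"
  unfolding twist_def[of A] proj_twist by (simp add: twist_def matrix_vector_mul_assoc)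

lemma twist_diff_proj: "A \<in> commutant0 \<Longrightarrow> twist A p - proj (twist A p) = p - proj p"
  by (simp add: proj_twist) (simp add: twist_def)

lemma modulus_twist_mult:
  "B \<in> commutant0 \<Longrightarrow> modulus (twist (A ** B)) = modulus (twist A) * modulus (twist B)"
  using modulus_comp[OF linear_twist linear_twist, of A B]
  by (simp add: o_def twist_comp)

lemma inner_twist: "A \<in> commutant0 \<Longrightarrow> twist A p \<bullet> p = (A *v proj p) \<bullet> proj p + (norm (p - proj p))\<^sup>2"
proof -
  assume A: "A \<in> commutant0"
  have "(A *v proj p) \<bullet> (p - proj p) = 0"
    using proj_orthogonal[of "A *v p" p] by (simp add: commutant0_proj[OF A])
  then have 1: "(A *v proj p) \<bullet> p = (A *v proj p) \<bullet> proj p" by (simp add: inner_diff_right)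
  have "proj p \<bullet> (p - proj p) = 0" by (rule proj_orthogonal)
  then have "(p - proj p) \<bullet> p = (p - proj p) \<bullet> (p - proj p)"
    by (simp add: inner_diff_right inner_diff_left inner_commute)
  with 1 show ?thesis by (simp add: twist_def inner_add_left power2_norm_eq_inner)
qed

text \<open>The base row of \<open>d\<close> times \<open>centring\<close>: the integral vector that represents the scalar \<open>d\<close>.\<close>
definition base_vec :: "real^'n" where
  "base_vec = (\<chi> j. (if i0 = j then real CARD('n) else 0) - 1)"

lemma base_vec_centring: "base_vec = real CARD('n) *\<^sub>R (centring $ i0)"
  by (auto simp: base_vec_def centring_def vec_eq_iff field_simps)

lemma base_vec_stab_fixed: "base_vec \<in> stab_fixed"
proof -
  have "real CARD('n) *\<^sub>R centring \<in> commutant0" using centring_commutant0 by (rule commutant0_scaleR)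
  from commutant0_row_stab_fixed[OF this] show ?thesis by (simp add: base_vec_centring)
qed

lemma base_vec_int: "base_vec \<in> int_lattice"
  by (simp add: base_vec_def int_lattice_def)

lemma norm_base_vec: "CARD('n) \<ge> 2 \<Longrightarrow> norm base_vec \<ge> 1"
  using component_le_norm_cart[of base_vec i0] by (simp add: base_vec_def)

text \<open>The scalar by which operators are rescaled to normalise their modulus.  Its value makes the lower
  estimate of \<open>modulus_ge\<close>, with \<open>K = 2\<^sup>d\<close>, exceed 1.\<close>
definition stretch_factor :: real where "stretch_factor = 4 * 2 ^ CARD('n)"

definition stretch_modulus :: real where
  "stretch_modulus = modulus (twist (stretch_factor *\<^sub>R centring))"

lemma stretch_factor_ge: "stretch_factor \<ge> 1"
  using one_le_power[of "2::real" "CARD('n)"] unfolding stretch_factor_def by linarith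

lemma stretch_modulus_gt_1:
  assumes "CARD('n) \<ge> 2"
  shows "stretch_modulus > 1"
proof -
  let ?A = "stretch_factor *\<^sub>R centring"
  have A: "?A \<in> commutant0" by (intro commutant0_scaleR centring_commutant0)
  have Aproj: "?A *v proj p = stretch_factor *\<^sub>R proj p" for p
    by (simp add: scaleR_matrix_vector_assoc[symmetric] centring_vec centred_id zero_sum_proj)
  have lower: "norm (twist ?A p) \<ge> 1 * norm p" for p
  proof (cases "p = 0")
    case False
    have "(norm p)\<^sup>2 \<le> stretch_factor * (norm (proj p))\<^sup>2 + (norm (p - proj p))\<^sup>2"
      using norm_proj_Pythagoras[of p] mult_right_mono[OF stretch_factor_ge, of "(norm (proj p))\<^sup>2"]
      by simp
    also have "\<dots> = twist ?A p \<bullet> p"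
      unfolding inner_twist[OF A] Aproj by (simp add: power2_norm_eq_inner)
    also have "\<dots> \<le> norm (twist ?A p) * norm p" by (rule norm_cauchy_schwarz)
    finally show ?thesis using False by (simp add: power2_eq_square)
  qed simp
  define e where "e = (1 / norm base_vec) *\<^sub>R base_vec"
  have nz: "norm base_vec > 0" using norm_base_vec[OF assms] by linarith
  have e1: "norm e = 1" using nz by (simp add: e_def)
  have "proj e = e" by (simp add: e_def linear_scale[OF linear_proj] proj_id base_vec_stab_fixed)
  then have "norm (twist ?A e) = stretch_factor"
    using stretch_factor_ge e1 Aproj[of e] by (simp add: twist_def)
  then have e2: "norm (twist ?A e) \<ge> 4 * 1 * real (2 ^ CARD('n))" by (simp add: stretch_factor_def)
  have "modulus (twist ?A) \<ge> (real (2 ^ CARD('n)) + 1) * (1 / 2) ^ CARD('n)"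
    by (rule modulus_ge[OF linear_twist lower _ e1 e2]) simp
  moreover have "(real (2 ^ CARD('n)) + 1) * (1 / 2) ^ CARD('n) > 1"
    by (simp add: field_simps power_divide)
  ultimately show ?thesis by (simp add: stretch_modulus_def)
qed

lemma modulus_twist_stretch:
  assumes A: "A \<in> commutant0"
  shows "modulus (twist (stretch_factor *\<^sub>R A)) = modulus (twist A) * stretch_modulus"
proof -
  have "stretch_factor *\<^sub>R A = A ** (stretch_factor *\<^sub>R centring)"
    by (simp add: matrix_scalar_ac scalar_matrix_assoc[symmetric] centring_unit[OF A])
  then show ?thesis
    by (simp add: stretch_modulus_def modulus_twist_mult commutant0_scaleR centring_commutant0)
qed

lemma modulus_twist_shrink:
  assumes A: "A \<in> commutant0" and "CARD('n) \<ge> 2"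
  shows "modulus (twist ((1 / stretch_factor ^ k) *\<^sub>R A)) = modulus (twist A) / stretch_modulus ^ k"
proof (induction k)
  case (Suc k)
  have "stretch_factor \<noteq> 0" using stretch_factor_ge by linarith
  then have "stretch_factor *\<^sub>R ((1 / stretch_factor ^ Suc k) *\<^sub>R A) = (1 / stretch_factor ^ k) *\<^sub>R A"
    by simp
  then have "modulus (twist ((1 / stretch_factor ^ Suc k) *\<^sub>R A)) * stretch_modulus
     = modulus (twist ((1 / stretch_factor ^ k) *\<^sub>R A))"
    using modulus_twist_stretch[OF commutant0_scaleR[OF A], of "1 / stretch_factor ^ Suc k"]
    by (simp only:)
  then show ?case
    using Suc stretch_modulus_gt_1[OF assms(2)] by (simp add: field_simps)
qed simp

text \<open>Twice this radius is still smaller than the reciprocal of the denominator in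
  \<open>proj_denominator\<close>, and vectors of length at most twice this radius are rows of
  contractions.\<close>
definition radius :: real where
  "radius = 1 / (4 * real (card stab) * real CARD('n))"

lemma radius: "radius > 0" "2 * radius < 1 / (real (card stab) * real CARD('n))"
  "real CARD('n) * (2 * radius) \<le> 1" "2 * radius < 1"
proof -
  have s: "real (card stab) \<ge> 1" using card_stab by simp
  have n: "real CARD('n) \<ge> 1" by simp
  have sn: "real (card stab) * real CARD('n) \<ge> 1" using mult_mono[OF s n] by simp
  show "radius > 0" "2 * radius < 1 / (real (card stab) * real CARD('n))"
    using card_stab by (auto simp: radius_def field_simps)
  show "real CARD('n) * (2 * radius) \<le> 1" using s by (simp add: radius_def field_simps)
  show "2 * radius < 1" using sn by (simp add: radius_def field_simps)
qed

definition ball_volume :: real where "ball_volume = measure lebesgue (cball (0::real^'n) radius)"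

lemma ball_volume_pos: "ball_volume > 0"
  unfolding ball_volume_def using content_cball_pos[OF radius(1), of "0::real^'n"] by simp

lemma ball_volume_eq: "ball_volume = radius ^ DIM(real^'n) * measure lebesgue (cball (0::real^'n) 1)"
  unfolding ball_volume_def by (rule measure_cball_scale) (use radius in simp)

lemma modulus_twist_transpose_of_row:
  assumes "norm q \<le> 2 * radius"
  shows "modulus (twist (transpose (of_row q))) \<le> 2 ^ CARD('n)"
proof (rule modulus_le[OF linear_twist])
  fix p
  have "norm (transpose (of_row q) *v proj p) \<le> real CARD('n) * norm q * norm (proj p)"
    by (rule norm_transpose_of_row_mult)
  also have "\<dots> \<le> 1 * norm (proj p)"
  proof (rule mult_right_mono)
    have "real CARD('n) * norm q \<le> real CARD('n) * (2 * radius)"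
      using assms by (intro mult_left_mono) auto
    then show "real CARD('n) * norm q \<le> 1" using radius(3) by linarith
  qed simp
  finally have "norm (transpose (of_row q) *v proj p) \<le> norm p"
    using norm_proj_le[of p] by simp
  moreover have "norm (twist (transpose (of_row q)) p)
      \<le> norm (transpose (of_row q) *v proj p) + norm (p - proj p)"
    unfolding twist_def by (rule norm_triangle_ineq)
  ultimately show "norm (twist (transpose (of_row q)) p) \<le> 2 * norm p"
    using norm_diff_proj_le[of p] by linarith
qed simp

text \<open>Shrink \<open>A\<close> to \<open>A'\<close> such that the image under its twist of a small ball has volume just above
  1.  Blichfeldt's theorem gives two points of this image whose difference is an integral vector.
  It is close to \<open>stab_fixed\<close>, hence in it, and of the form \<open>A' q\<close> with \<open>q\<close> small; as \<open>A'\<close> is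
  symmetric, it is the base row of \<open>X = of_row q ** A'\<close>.  The bound on the modulus of \<open>X\<close> does
  not depend on \<open>A\<close>, thanks to the normalisation of the volume.\<close>
lemma small_integral_element:
  assumes d: "CARD('n) \<ge> 2"
    and A: "A \<in> commutant0" "transpose A = A" "modulus (twist A) * ball_volume > 1"
  obtains X where "X \<in> commutant0" "int_matrix X" "X \<noteq> 0"
    "\<And>v. norm (X *v v) \<le> norm (A *v v)"
    "modulus (twist (transpose X)) \<le> stretch_modulus / ball_volume * 2 ^ CARD('n)"
proof -
  obtain k where k: "1 < modulus (twist A) * ball_volume / stretch_modulus ^ k"
    "modulus (twist A) * ball_volume / stretch_modulus ^ k \<le> stretch_modulus"
    using exists_normalising_power[OF stretch_modulus_gt_1[OF d] A(3)] by blast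
  define c where "c = 1 / stretch_factor ^ k"
  have c: "0 \<le> c" "c \<le> 1"
    using stretch_factor_ge by (auto simp: c_def divide_simps intro: less_le_trans)
  define A' where "A' = c *\<^sub>R A"
  have A': "A' \<in> commutant0" "transpose A' = A'"
    using A by (simp_all add: A'_def commutant0_scaleR transpose_scalar)
  have mod: "modulus (twist A') = modulus (twist A) / stretch_modulus ^ k"
    unfolding A'_def c_def by (rule modulus_twist_shrink[OF A(1) d])
  have gt: "modulus (twist A') * ball_volume > 1" and le: "modulus (twist A') * ball_volume \<le> stretch_modulus"
    using k by (simp_all add: mod)
  let ?S = "twist A' ` cball 0 radius"
  have "measure lebesgue ?S > 1"
    using gt by (simp only: measure_linear_image_modulus[OF linear_twist lmeasurable_cball] ball_volume_def)
  moreover have "?S \<in> lmeasurable" by (rule lmeasurable_linear_image[OF linear_twist]) simp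
  moreover have "bounded ?S"
    by (intro bounded_linear_image) (auto simp: linear_twist linear_conv_bounded_linear[symmetric])
  ultimately obtain x y where xy: "x \<in> ?S" "y \<in> ?S" "x \<noteq> y" "x - y \<in> int_lattice"
    using Blichfeldt by metis
  obtain a b where ab: "norm a \<le> radius" "norm b \<le> radius" "x = twist A' a" "y = twist A' b"
    using xy by auto
  define q where "q = a - b"
  have q: "norm q \<le> 2 * radius" using norm_triangle_ineq4[of a b] ab by (simp add: q_def)
  define p where "p = x - y"
  have p: "p = twist A' q" by (simp add: p_def q_def ab linear_diff[OF linear_twist])
  have "norm (p - proj p) \<le> norm q"
    unfolding p twist_diff_proj[OF A'(1)] by (rule norm_diff_proj_le)
  then have pp: "proj p = p"
    using xy(4) q radius(2) by (intro int_lattice_near_proj) (auto simp: p_def)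
  then have qq: "proj q = q"
    using twist_diff_proj[OF A'(1), of q] p by simp
  have pf: "p \<in> stab_fixed" "q \<in> stab_fixed" using proj_stab_fixed pp qq by metis+
  have pA: "p = A' *v q" using p qq by (simp add: twist_def)
  have X: "of_row p = of_row q ** A'"
  proof (rule commutant0_eqI)
    show "of_row p $ i0 = (of_row q ** A') $ i0"
      by (simp only: matrix_mult_row of_row_row[OF pf(1)] of_row_row[OF pf(2)] A'(2) pA[symmetric])
  qed (auto intro: of_row_commutant0 pf commutant0_mult A')
  show thesis
  proof
    show "of_row p \<in> commutant0" by (rule of_row_commutant0[OF pf(1)])
    show "int_matrix (of_row p)" using xy(4) by (intro of_row_int) (simp add: p_def)
    show "of_row p \<noteq> 0"
    proof
      assume "of_row p = 0"
      then have "p = 0" using of_row_row[OF pf(1)] by simp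
      then show False using xy(3) by (simp add: p_def)
    qed
    show "norm (of_row p *v v) \<le> norm (A *v v)" for v
    proof -
      have "norm (of_row p *v v) \<le> real CARD('n) * norm q * norm (A' *v v)"
        unfolding X matrix_vector_mul_assoc[symmetric] by (rule norm_of_row_mult)
      also have "\<dots> \<le> 1 * norm (A' *v v)"
      proof (rule mult_right_mono)
        have "real CARD('n) * norm q \<le> real CARD('n) * (2 * radius)"
          using q by (intro mult_left_mono) auto
        then show "real CARD('n) * norm q \<le> 1" using radius(3) by linarith
      qed simp
      also have "\<dots> = c * norm (A *v v)"
        using c by (simp add: A'_def scaleR_matrix_vector_assoc[symmetric])
      also have "\<dots> \<le> 1 * norm (A *v v)"
        using c by (intro mult_right_mono) auto
      finally show ?thesis by simp
    qed
    have "modulus (twist (transpose (of_row p)))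
        = modulus (twist A') * modulus (twist (transpose (of_row q)))"
      by (simp add: X matrix_transpose_mul A'(2) modulus_twist_mult commutant0_transpose
          of_row_commutant0 pf)
    also have "\<dots> \<le> stretch_modulus / ball_volume * 2 ^ CARD('n)"
      using le ball_volume_pos stretch_modulus_gt_1[OF d]
      by (intro mult_mono modulus_twist_transpose_of_row q modulus_nonneg) (auto simp: field_simps)
    finally show "modulus (twist (transpose (of_row p))) \<le> stretch_modulus / ball_volume * 2 ^ CARD('n)" .
  qed
qed

text \<open>Integral elements for which a nonzero multiple \<open>k d\<close> of the inverse is integral, with \<open>|k| \<le> K\<close>.\<close>
definition quasi_invertible :: "nat \<Rightarrow> real^'n^'n \<Rightarrow> bool" where
  "quasi_invertible K X \<longleftrightarrow> X \<in> commutant0 \<and> int_matrix X \<and>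
     (\<exists>Z\<in>commutant0. \<exists>k::int. int_matrix Z \<and> k \<noteq> 0 \<and> \<bar>k\<bar> \<le> int K \<and>
        Z ** X = (of_int k * real CARD('n)) *\<^sub>R centring)"

lemma Ints_Rats: "x \<in> \<int> \<Longrightarrow> x \<in> (\<rat> :: real set)"
  using Ints_subset_Rats by blast

text \<open>The equation \<open>Z X = k d\<close> is solved in base rows.  Apply Blichfeldt's theorem to the preimage under
  the twist of \<open>X\<^sup>T\<close> of a union of \<open>K + 1\<close> small balls around multiples of \<open>base_vec\<close>, whose volume exceeds
  1.  The resulting integral vector is mapped by \<open>X\<^sup>T\<close> to within distance less than 1 of an integral
  multiple of \<open>base_vec\<close>, so it is mapped exactly to it.\<close>
lemma quasi_invertibleI:
  assumes QI: "QI_group G" and d: "CARD('n) \<ge> 2"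
    and X: "X \<in> commutant0" "int_matrix X" "X \<noteq> 0"
    and K: "modulus (twist (transpose X)) < (real K + 1) * ball_volume"
  shows "quasi_invertible K X"
proof -
  let ?T = "transpose X"
  have T: "?T \<in> commutant0" "int_matrix ?T" "?T \<noteq> 0"
    using X by (auto simp: commutant0_transpose int_matrix_transpose)
       (metis transpose_transpose transpose_mat mat_0)
  have inj: "inj (twist ?T)"
  proof (rule linear_injective_0[THEN iffD2, OF linear_twist], safe)
    fix p assume p: "twist ?T p = 0"
    have "?T *v proj p = 0"
      using proj_twist[OF T(1), of p] p linear_0[OF linear_proj] by simp
    then have "proj p = 0"
      using T by (intro commutant0_injective[OF QI T(1) _ T(3) zero_sum_proj])
        (auto simp: int_matrix_def Ints_Rats)
    then show "p = 0" using p by (simp add: twist_def)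
  qed
  obtain g where g: "linear g" "\<And>x. g (twist ?T x) = x" "\<And>x. twist ?T (g x) = x"
    using linear_injective_isomorphism[OF linear_twist inj] by blast
  have mg: "modulus (twist ?T) * modulus g = 1"
    by (rule modulus_inverse[OF linear_twist g(1)]) (use g(3) in auto)
  (* The base row of Z ** X is the image of the base row of Z under the transpose of X. *)
  define Y where "Y = (\<Union>k\<in>{..K}. cball (real k *\<^sub>R base_vec) radius)"
  have Ym: "Y \<in> lmeasurable" unfolding Y_def by (intro fmeasurable.finite_UN) auto
  have "measure lebesgue Y \<ge> (real K + 1) * radius ^ DIM(real^'n) * measure lebesgue (cball (0::real^'n) 1)"
    by (rule measure_ge_ball_progression[of _ base_vec])
       (use radius norm_base_vec[OF d] Ym in \<open>auto simp: Y_def\<close>)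
  then have "measure lebesgue Y \<ge> (real K + 1) * ball_volume" by (simp add: ball_volume_eq mult.assoc)
  then have Yg: "measure lebesgue Y > modulus (twist ?T)" using K by linarith
  have mpos: "modulus g > 0" using mg modulus_nonneg[of g] by (cases "modulus g = 0") auto
  have "1 < modulus g * measure lebesgue Y"
    using mult_strict_left_mono[OF Yg mpos] mg by (simp add: mult.commute)
  then have "measure lebesgue (g ` Y) > 1" by (simp only: measure_linear_image_modulus[OF g(1) Ym])
  moreover have "g ` Y \<in> lmeasurable" by (rule lmeasurable_linear_image[OF g(1) Ym])
  moreover have "bounded (g ` Y)"
    using g(1) by (intro bounded_linear_image) (auto simp: Y_def linear_conv_bounded_linear[symmetric])
  ultimately obtain x y where xy: "x \<in> Y" "y \<in> Y" "g x \<noteq> g y" "g x - g y \<in> int_lattice"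
    using Blichfeldt[of "g ` Y"] by auto
  obtain a b where ab: "a \<le> K" "b \<le> K" "norm (x - real a *\<^sub>R base_vec) \<le> radius"
     "norm (y - real b *\<^sub>R base_vec) \<le> radius"
    using xy by (auto simp: Y_def dist_norm norm_minus_commute)
  define k where "k = int a - int b"
  define e where "e = (x - real a *\<^sub>R base_vec) - (y - real b *\<^sub>R base_vec)"
  have e: "norm e \<le> 2 * radius"
    unfolding e_def using norm_triangle_ineq4[of "x - real a *\<^sub>R base_vec" "y - real b *\<^sub>R base_vec"] ab
    by linarith
  have xye: "x - y = of_int k *\<^sub>R base_vec + e" by (simp add: e_def k_def algebra_simps)
  define r where "r = g x - g y"
  have tr: "twist ?T r = of_int k *\<^sub>R base_vec + e"
    unfolding r_def linear_diff[OF linear_twist] g(3) by (rule xye)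
  have "r - proj r = e - proj e"
    using twist_diff_proj[OF T(1), of r] unfolding tr
    by (simp add: linear_add[OF linear_proj] linear_scale[OF linear_proj] proj_id base_vec_stab_fixed)
  then have "norm (r - proj r) \<le> norm e" using norm_diff_proj_le by simp
  then have rr: "proj r = r"
    using xy(4) e radius(2) by (intro int_lattice_near_proj) (auto simp: r_def)
  then have Tr: "?T *v r = of_int k *\<^sub>R base_vec + e" using tr by (simp add: twist_def)
  have "e = ?T *v r - of_int k *\<^sub>R base_vec" by (simp only: Tr) simp
  also have "\<dots> \<in> int_lattice"
    using T(2) xy(4) base_vec_int
    by (intro int_lattice_diff int_matrix_vec int_lattice_scale) (auto simp: r_def)
  finally have "e = 0" using e radius(4) by (intro int_lattice_eq_0) auto
  then have Tr: "?T *v r = of_int k *\<^sub>R base_vec" using Tr by simp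
  have rf: "r \<in> stab_fixed" using proj_stab_fixed rr by metis
  have k0: "k \<noteq> 0"
  proof
    assume "k = 0"
    then have "twist ?T r = twist ?T 0" using tr \<open>e = 0\<close> by (simp add: linear_0[OF linear_twist])
    then have "r = 0" using inj by (simp add: inj_eq)
    then show False using xy(3) by (simp add: r_def)
  qed
  have "of_row r ** X = (of_int k * real CARD('n)) *\<^sub>R centring"
  proof (rule commutant0_eqI)
    show "(of_row r ** X) $ i0 = ((of_int k * real CARD('n)) *\<^sub>R centring) $ i0"
      by (simp only: matrix_mult_row of_row_row[OF rf] Tr base_vec_centring) simp
  qed (auto intro: of_row_commutant0 rf commutant0_mult X commutant0_scaleR centring_commutant0)
  then show ?thesis
    unfolding quasi_invertible_def using X of_row_commutant0[OF rf] k0 ab xy(4)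
    by (auto simp: k_def r_def intro!: bexI[of _ "of_row r"] exI[of _ k] of_row_int)
qed

end

section \<open>Units of the integral commutant\<close>

lemma finite_set_of_representatives:
  assumes "finite (f ` A)"
  shows "\<exists>F. finite F \<and> F \<subseteq> A \<and> (\<forall>x\<in>A. \<exists>y\<in>F. f y = f x)"
proof -
  obtain F where F: "F \<subseteq> A" "finite F" "f ` A = f ` F"
    using finite_subset_image[OF assms subset_refl] by blast
  have "\<exists>y\<in>F. f y = f x" if "x \<in> A" for x
    using imageI[OF that, of f] unfolding F(3) by force
  with F show ?thesis by blast
qed

lemma mat_add_rdistrib: "(A + B) ** C = A ** C + B ** (C :: real^'n^'m)"
  and mat_diff_rdistrib: "(A - B) ** C = A ** C - B ** (C :: real^'n^'m)"
  by (simp_all add: vec_eq_iff matrix_matrix_mult_def sum.distrib sum_subtractf algebra_simps)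

lemma scaleR_mat_mult: "(c *\<^sub>R A) ** B = c *\<^sub>R (A ** B)" "A ** (c *\<^sub>R B) = c *\<^sub>R (A ** (B :: real^'n^'m))"
  by (simp_all add: vec_eq_iff matrix_matrix_mult_def sum_distrib_left mult_ac)

lemma transpose_eq_0_iff: "transpose A = 0 \<longleftrightarrow> A = (0 :: real^'n^'m)"
  by (auto simp: transpose_def vec_eq_iff)

context transitive_action
begin

lemma int_no_zero_divisors:
  assumes "QI_group G" "A \<in> commutant0" "int_matrix A" "A \<noteq> 0" "B \<in> commutant0" "A ** B = 0"
  shows "B = 0"
proof -
  have "A $ i $ j \<in> \<rat>" for i j
    using assms(3) by (simp add: int_matrix_def Ints_Rats)
  then show ?thesis using commutant0_no_zero_divisors[OF assms(1,2) _ assms(4-6)] by blast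
qed

text \<open>The units of the integral commutant that fix the all-one vector, represented by their difference
  from the identity, which lies in \<open>commutant0\<close>.\<close>
definition integral_unit :: "real^'n^'n \<Rightarrow> bool" where
  "integral_unit D \<longleftrightarrow> D \<in> commutant0 \<and> int_matrix D \<and>
     (\<exists>D'\<in>commutant0. int_matrix D' \<and> (mat 1 + D) ** (mat 1 + D') = mat 1)"

lemma integral_unit_0: "integral_unit 0"
  by (auto simp: integral_unit_def commutant0_def int_matrix_def intro!: bexI[of _ 0])

lemma unit_mult: "(mat 1 + D) ** (mat 1 + E) = mat 1 + (D + E + D ** (E :: real^'n^'n))"
  by (simp add: matrix_add_ldistrib mat_add_rdistrib)

lemma int_matrix_unit_mult:
  "int_matrix D \<Longrightarrow> int_matrix E \<Longrightarrow> int_matrix (D + E + D ** (E :: real^'n^'n))"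
  using int_matrix_mult[of D E] by (simp add: int_matrix_def)

lemma commutant0_unit_mult:
  "D \<in> commutant0 \<Longrightarrow> E \<in> commutant0 \<Longrightarrow> D + E + D ** E \<in> commutant0"
  by (intro commutant0_add commutant0_mult)

lemma integral_unit_comp:
  assumes "integral_unit D" "integral_unit E"
  shows "integral_unit (D + E + D ** E)"
proof -
  obtain D' E' where D': "D' \<in> commutant0" "int_matrix D'" "(mat 1 + D) ** (mat 1 + D') = mat 1"
    and E': "E' \<in> commutant0" "int_matrix E'" "(mat 1 + E) ** (mat 1 + E') = mat 1"
    using assms by (auto simp: integral_unit_def)
  have "(mat 1 + (D + E + D ** E)) ** (mat 1 + (E' + D' + E' ** D'))
      = (mat 1 + D) ** ((mat 1 + E) ** (mat 1 + E')) ** (mat 1 + D')"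
    unfolding unit_mult[symmetric] by (simp only: matrix_mul_assoc)
  also have "\<dots> = mat 1" by (simp add: E' D')
  finally show ?thesis
    using assms D' E' unfolding integral_unit_def
    by (auto intro!: bexI[of _ "E' + D' + E' ** D'"] int_matrix_unit_mult commutant0_unit_mult)
qed

lemma quasi_invertibleD:
  assumes "quasi_invertible K X"
  shows "X \<in> commutant0" "int_matrix X"
  using assms by (auto simp: quasi_invertible_def)

lemma centring_nonzero: "CARD('n) \<ge> 2 \<Longrightarrow> centring \<noteq> 0"
proof
  assume "CARD('n) \<ge> 2" "centring = 0"
  then have "centring $ i0 $ i0 = 0" by simp
  with \<open>CARD('n) \<ge> 2\<close> show False by (simp add: centring_def)
qed

text \<open>In an algebra without zero divisors a left inverse is a right inverse.\<close>
lemma quasi_inverse_right: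
  assumes QI: "QI_group G" and X: "X \<in> commutant0" "int_matrix X" "X \<noteq> 0"
    and Z: "Z \<in> commutant0" "Z ** X = c *\<^sub>R centring"
  shows "X ** Z = c *\<^sub>R centring"
proof -
  define N where "N = X ** Z - c *\<^sub>R centring"
  have N: "N \<in> commutant0"
    unfolding N_def by (intro commutant0_diff commutant0_mult commutant0_scaleR centring_commutant0 X Z)
  have "N ** X = X ** (Z ** X) - c *\<^sub>R (centring ** X)"
    by (simp add: N_def mat_diff_rdistrib scaleR_mat_mult matrix_mul_assoc)
  also have "\<dots> = 0"
    by (simp add: Z scaleR_mat_mult centring_unit[OF X(1)])
  finally have NX: "N ** X = 0" .
  have "transpose X ** transpose N = transpose (N ** X)" by (simp only: matrix_transpose_mul)
  also have "\<dots> = 0" by (simp only: NX transpose_eq_0_iff)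
  finally have prod: "transpose X ** transpose N = 0" .
  have "transpose X \<noteq> 0" using X(3) by (simp only: transpose_eq_0_iff not_False_eq_True)
  then have "transpose N = 0"
    by (rule int_no_zero_divisors[OF QI commutant0_transpose[OF X(1)] int_matrix_transpose[OF X(2)] _
        commutant0_transpose[OF N] prod])
  then have "N = 0" by (simp only: transpose_eq_0_iff)
  then show ?thesis by (simp add: N_def)
qed

lemma quasi_invertible_nonzero:
  assumes "CARD('n) \<ge> 2" "quasi_invertible K X"
  shows "X \<noteq> 0"
proof
  assume "X = 0"
  then obtain k :: int where "k \<noteq> 0" "(of_int k * real CARD('n)) *\<^sub>R centring = 0"
    using assms(2) by (auto simp: quasi_invertible_def)
  then show False using centring_nonzero[OF assms(1)] by simp
qed

text \<open>On vectors of zero sum, \<open>X\<^sup>-\<^sup>1 Y = 1 + X\<^sup>-\<^sup>1 (Y - X)\<close>, and \<open>X\<^sup>-\<^sup>1 = Z / (k d)\<close>.  The denominator is absorbed by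
  the congruence because \<open>k\<close> divides \<open>K!\<close>.\<close>
lemma integral_quotient:
  assumes QI: "QI_group G" and d: "CARD('n) \<ge> 2"
    and X: "quasi_invertible K X"
    and Y: "Y \<in> commutant0" "\<And>i j. (Y - X) $ i $ j / (real CARD('n) * fact K) \<in> \<int>"
  shows "\<exists>D\<in>commutant0. int_matrix D \<and> X ** (mat 1 + D) = Y"
proof -
  note X' = quasi_invertibleD[OF X]
  obtain Z and k :: int where Z: "Z \<in> commutant0" "int_matrix Z" "k \<noteq> 0" "\<bar>k\<bar> \<le> int K"
    "Z ** X = (of_int k * real CARD('n)) *\<^sub>R centring"
    using X by (auto simp: quasi_invertible_def)
  have XZ: "X ** Z = (of_int k * real CARD('n)) *\<^sub>R centring"
    by (rule quasi_inverse_right[OF QI X' quasi_invertible_nonzero[OF d X] Z(1,5)])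
  define c where "c = of_int k * real CARD('n)"
  have c: "c \<noteq> 0" using Z(3) by (simp add: c_def)
  define E where "E = (1 / c) *\<^sub>R (Y - X)"
  have E: "E \<in> commutant0" unfolding E_def by (intro commutant0_scaleR commutant0_diff Y X')
  have "int_matrix E"
    unfolding int_matrix_def
  proof safe
    fix i j
    obtain m where m: "fact K = k * m"
    proof -
      have "nat \<bar>k\<bar> dvd fact K" by (rule dvd_fact) (use Z in auto)
      then have "int (nat \<bar>k\<bar>) dvd int (fact K)" by (simp only: of_nat_dvd_iff)
      then have "k dvd fact K" by simp
      then show ?thesis using that by (auto simp: dvd_def)
    qed
    have "(fact K :: real) = of_int (fact K)" by simp
    also have "\<dots> = of_int k * of_int m" by (simp only: m of_int_mult)
    finally have f: "(fact K :: real) = of_int k * of_int m" .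
    have "E $ i $ j = of_int m * ((Y - X) $ i $ j / (real CARD('n) * fact K))"
    proof -
      have "(of_int m :: real) \<noteq> 0"
        using f fact_nonzero[of K, where ?'a = real] by auto
      then show ?thesis using Z(3) unfolding f by (simp add: E_def c_def field_simps)
    qed
    also have "\<dots> \<in> \<int>" using Y(2) by (intro Ints_mult) auto
    finally show "E $ i $ j \<in> \<int>" .
  qed
  moreover have "X ** (mat 1 + Z ** E) = Y"
  proof -
    have "X ** (Z ** E) = c *\<^sub>R E"
      by (simp add: matrix_mul_assoc XZ scaleR_mat_mult centring_unit[OF E] flip: c_def)
    then show ?thesis using c by (simp add: matrix_add_ldistrib E_def)
  qed
  ultimately show ?thesis
    using Z E by (intro bexI[of _ "Z ** E"]) (auto intro: int_matrix_mult commutant0_mult)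
qed

text \<open>The quotients \<open>X\<^sup>-\<^sup>1 Y\<close> and \<open>Y\<^sup>-\<^sup>1 X\<close> are both integral, and they are inverse to each other.\<close>
lemma congruent_imp_associated:
  assumes QI: "QI_group G" and d: "CARD('n) \<ge> 2"
    and X: "quasi_invertible K X" and Y: "quasi_invertible K Y"
    and cong: "\<And>i j. (Y - X) $ i $ j / (real CARD('n) * fact K) \<in> \<int>"
  shows "\<exists>D. integral_unit D \<and> X ** (mat 1 + D) = Y"
proof -
  have cong': "(X - Y) $ i $ j / (real CARD('n) * fact K) \<in> \<int>" for i j
    using Ints_minus[OF cong[of i j]] by (simp add: minus_divide_left)
  obtain D where D: "D \<in> commutant0" "int_matrix D" "X ** (mat 1 + D) = Y"
    using integral_quotient[OF QI d X quasi_invertibleD(1)[OF Y] cong] by blast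
  obtain D' where D': "D' \<in> commutant0" "int_matrix D'" "Y ** (mat 1 + D') = X"
    using integral_quotient[OF QI d Y quasi_invertibleD(1)[OF X] cong'] by blast
  define N where "N = D + D' + D ** D'"
  have N: "N \<in> commutant0" unfolding N_def by (intro commutant0_unit_mult D D')
  have "X ** (mat 1 + N) = X"
    unfolding N_def unit_mult[symmetric] matrix_mul_assoc D D' ..
  then have "X ** N = 0" by (simp add: matrix_add_ldistrib)
  then have "N = 0"
    by (rule int_no_zero_divisors[OF QI quasi_invertibleD[OF X] quasi_invertible_nonzero[OF d X] N])
  then have "(mat 1 + D) ** (mat 1 + D') = mat 1"
    by (simp add: unit_mult N_def[symmetric])
  then show ?thesis using D D' by (auto simp: integral_unit_def)
qed

text \<open>The operator \<open>Z / (k d)\<close> is a left inverse on vectors of zero sum.\<close>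
lemma quasi_invertible_bounded_below:
  assumes "quasi_invertible K X"
  shows "\<exists>c\<ge>0. \<forall>v\<in>zero_sum. norm v \<le> c * norm (X *v v)"
proof -
  obtain Z and k :: int where Z: "k \<noteq> 0" "Z ** X = (of_int k * real CARD('n)) *\<^sub>R centring"
    using assms by (auto simp: quasi_invertible_def)
  define c where "c = of_int k * real CARD('n)"
  have c: "\<bar>c\<bar> > 0" using Z(1) by (simp add: c_def)
  have bl: "bounded_linear ((*v) Z)" by (simp add: linear_conv_bounded_linear[symmetric])
  have "norm v \<le> (onorm ((*v) Z) / \<bar>c\<bar>) * norm (X *v v)" if "v \<in> zero_sum" for v
  proof -
    have "Z *v (X *v v) = c *\<^sub>R v"
      using Z(2) centred_id[OF that]
      by (simp add: matrix_vector_mul_assoc c_def scaleR_matrix_vector_assoc[symmetric] centring_vec)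
    then have "\<bar>c\<bar> * norm v \<le> onorm ((*v) Z) * norm (X *v v)"
      using onorm[OF bl, of "X *v v"] by simp
    then show ?thesis using c by (simp add: field_simps)
  qed
  then show ?thesis using onorm_pos_le[OF bl] by (intro exI[of _ "onorm ((*v) Z) / \<bar>c\<bar>"]) auto
qed

text \<open>Choose one representative \<open>Y\<close> for each residue class of entries modulo \<open>d K!\<close>.  Then \<open>X = Y u\<close> for a
  unit \<open>u\<close>, and the finitely many \<open>Y\<close> have a common lower bound.\<close>
lemma quasi_invertible_unit_bound:
  assumes QI: "QI_group G" and d: "CARD('n) \<ge> 2"
  shows "\<exists>c\<ge>1. \<forall>X. quasi_invertible K X \<longrightarrow>
     (\<exists>D. integral_unit D \<and> (\<forall>v\<in>zero_sum. norm ((mat 1 + D) *v v) \<le> c * norm (X *v v)))"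
proof -
  define q :: int where "q = int CARD('n) * fact K"
  have q: "q > 0" by (simp add: q_def)
  define \<rho> :: "real^'n^'n \<Rightarrow> 'n \<Rightarrow> 'n \<Rightarrow> int" where "\<rho> X i j = \<lfloor>X $ i $ j\<rfloor> mod q" for X i j
  let ?A = "{X. quasi_invertible K X}"
  have "finite (\<rho> ` ?A)"
  proof (rule finite_subset)
    show "\<rho> ` ?A \<subseteq> Pi\<^sub>E UNIV (\<lambda>_. Pi\<^sub>E UNIV (\<lambda>_. {0..<q}))"
      using q by (auto simp: \<rho>_def)
  qed (auto intro!: finite_PiE)
  then obtain F where F: "finite F" "F \<subseteq> ?A" "\<And>X. X \<in> ?A \<Longrightarrow> \<exists>Y\<in>F. \<rho> Y = \<rho> X"
    using finite_set_of_representatives[of \<rho> ?A] by blast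
  have "\<forall>X\<in>F. \<exists>c\<ge>0. \<forall>v\<in>zero_sum. norm v \<le> c * norm (X *v v)"
    using F(2) quasi_invertible_bounded_below by blast
  then obtain c where c: "\<And>X. X \<in> F \<Longrightarrow> c X \<ge> 0"
    "\<And>X v. X \<in> F \<Longrightarrow> v \<in> zero_sum \<Longrightarrow> norm v \<le> c X * norm (X *v v)"
    by metis
  have csum: "c X \<le> 1 + sum c F" if "X \<in> F" for X
    using member_le_sum[OF that, of c] c(1) F(1) by (simp add: add_increasing)
  show ?thesis
  proof (rule exI[of _ "1 + sum c F"], intro conjI allI impI)
    show "1 \<le> 1 + sum c F" using c(1) by (simp add: sum_nonneg)
    fix X assume X: "quasi_invertible K X"
    then obtain Y where Y: "Y \<in> F" "\<rho> Y = \<rho> X" using F(3) by auto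
    have Yq: "quasi_invertible K Y" using Y F(2) by blast
    have "(X - Y) $ i $ j / (real CARD('n) * fact K) \<in> \<int>" for i j
    proof -
      have "X $ i $ j \<in> \<int>" "Y $ i $ j \<in> \<int>"
        using quasi_invertibleD(2)[OF X] quasi_invertibleD(2)[OF Yq] by (auto simp: int_matrix_def)
      then obtain x y :: int where xy: "X $ i $ j = of_int x" "Y $ i $ j = of_int y"
        by (auto elim!: Ints_cases)
      have "x mod q = y mod q"
        using fun_cong[OF fun_cong[OF Y(2), of i], of j] by (simp add: \<rho>_def xy)
      then have "q dvd x - y" by (simp add: mod_eq_dvd_iff)
      then obtain m where m: "x - y = q * m" by (auto simp: dvd_def)
      have "(X - Y) $ i $ j = of_int (q * m)" unfolding m[symmetric] by (simp add: xy)
      also have "\<dots> = (real CARD('n) * fact K) * of_int m" by (simp add: q_def)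
      finally show ?thesis by simp
    qed
    then obtain D where D: "integral_unit D" "Y ** (mat 1 + D) = X"
      using congruent_imp_associated[OF QI d Yq X] by blast
    have "norm ((mat 1 + D) *v v) \<le> (1 + sum c F) * norm (X *v v)" if v: "v \<in> zero_sum" for v
    proof -
      have "(mat 1 + D) *v v \<in> zero_sum"
        using D(1) v commutant0_range[of D v]
        by (simp add: integral_unit_def matrix_vector_mult_add_rdistrib subspace_add[OF subspace_zero_sum])
      then have "norm ((mat 1 + D) *v v) \<le> c Y * norm (X *v v)"
        using c(2)[OF Y(1), of "(mat 1 + D) *v v"] by (simp only: matrix_vector_mul_assoc D(2))
      also have "\<dots> \<le> (1 + sum c F) * norm (X *v v)"
        using csum[OF Y(1)] by (intro mult_right_mono) auto
      finally show ?thesis .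
    qed
    with D(1) show "\<exists>D. integral_unit D \<and>
        (\<forall>v\<in>zero_sum. norm ((mat 1 + D) *v v) \<le> (1 + sum c F) * norm (X *v v))" by blast
  qed
qed

text \<open>The compactness statement behind Dirichlet's unit theorem, for a division algebra in place of a
  number field: each symmetric operator of large modulus dominates a unit up to a constant factor.\<close>
theorem unit_approximation:
  assumes QI: "QI_group G" and d: "CARD('n) \<ge> 2"
  shows "\<exists>c\<ge>1. \<forall>A\<in>commutant0. transpose A = A \<and> modulus (twist A) * ball_volume > 1 \<longrightarrow>
     (\<exists>D. integral_unit D \<and> (\<forall>v\<in>zero_sum. norm ((mat 1 + D) *v v) \<le> c * norm (A *v v)))"
proof -
  define B where "B = stretch_modulus / ball_volume * 2 ^ CARD('n)"
  obtain K :: nat where "B / ball_volume < real K" using reals_Archimedean2 by blast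
  then have K: "B < (real K + 1) * ball_volume" using ball_volume_pos by (simp add: field_simps)
  obtain c where c: "c \<ge> 1" "\<And>X. quasi_invertible K X \<Longrightarrow>
     \<exists>D. integral_unit D \<and> (\<forall>v\<in>zero_sum. norm ((mat 1 + D) *v v) \<le> c * norm (X *v v))"
    using quasi_invertible_unit_bound[OF QI d] by blast
  have "\<exists>D. integral_unit D \<and> (\<forall>v\<in>zero_sum. norm ((mat 1 + D) *v v) \<le> c * norm (A *v v))"
    if A: "A \<in> commutant0" "transpose A = A" "modulus (twist A) * ball_volume > 1" for A
  proof -
    obtain X where X: "X \<in> commutant0" "int_matrix X" "X \<noteq> 0"
      "\<And>v. norm (X *v v) \<le> norm (A *v v)" "modulus (twist (transpose X)) \<le> B"
      using small_integral_element[OF d A] unfolding B_def by blast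
    have "quasi_invertible K X"
      using X(5) K by (intro quasi_invertibleI[OF QI d X(1-3)]) linarith
    then obtain D where D: "integral_unit D"
      "\<And>v. v \<in> zero_sum \<Longrightarrow> norm ((mat 1 + D) *v v) \<le> c * norm (X *v v)"
      using c(2) by blast
    have "norm ((mat 1 + D) *v v) \<le> c * norm (A *v v)" if "v \<in> zero_sum" for v
      using D(2)[OF that] mult_left_mono[OF X(4)[of v], of c] c(1) by linarith
    with D(1) show ?thesis by blast
  qed
  with c(1) show ?thesis by blast
qed

end

section \<open>The orbit form of a vector\<close>

lemma zero_sum_plus_const:
  fixes x :: "real^'n"
  assumes "x \<in> zero_sum"
  shows "(norm (x + vec c))\<^sup>2 = (norm x)\<^sup>2 + real CARD('n) * c\<^sup>2"
proof -
  have "x \<bullet> vec c = 0"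
    using assms by (simp add: inner_vec_def zero_sum_def sum_distrib_right[symmetric])
  then have "(norm (x + vec c))\<^sup>2 = (norm x)\<^sup>2 + (norm (vec c :: real^'n))\<^sup>2"
    by (intro norm_add_Pythagorean) (simp add: orthogonal_def)
  moreover have "(norm (vec c :: real^'n))\<^sup>2 = real CARD('n) * c\<^sup>2"
    unfolding power2_norm_eq_inner by (simp add: inner_vec_def power2_eq_square)
  ultimately show ?thesis by simp
qed

lemma norm_centred: "(norm (v :: real^'n))\<^sup>2 = (norm (centred v))\<^sup>2 + real CARD('n) * (mean v)\<^sup>2"
  using zero_sum_plus_const[OF centred_zero_sum, of v "mean v"] by (simp add: centred_def)

lemma norm_centred_le: "norm (centred (v :: real^'n)) \<le> norm v"
proof (rule power2_le_imp_le)
  show "(norm (centred v))\<^sup>2 \<le> (norm v)\<^sup>2" using norm_centred[of v] by simp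
qed simp

lemma mean_add: "mean (v + w) = mean v + mean w" and mean_vec: "mean (vec c :: real^'n) = c"
  by (simp_all add: mean_def sum.distrib add_divide_distrib)

lemma centred_plus_const: "centred (v + vec c) = centred (v :: real^'n)"
  by (simp add: centred_def mean_add mean_vec vec_eq_iff)

lemma inner_centred: "v \<in> zero_sum \<Longrightarrow> v \<bullet> centred w = v \<bullet> (w :: real^'n)"
  by (simp add: centred_def inner_diff_right)
     (simp add: inner_vec_def zero_sum_def sum_distrib_right[symmetric])

context transitive_action
begin

text \<open>The operator \<open>\<Sum>g. (g v)(g v)\<^sup>T\<close>, with the sum taken over the inverses of the group elements.\<close>
definition orbit_form :: "real^'n \<Rightarrow> real^'n^'n" where
  "orbit_form v = (\<chi> i j. \<Sum>g\<in>G. v $ g i * v $ g j)"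

text \<open>The action of the inverse of \<open>g\<close>.\<close>
definition pullback :: "('n \<Rightarrow> 'n) \<Rightarrow> real^'n \<Rightarrow> real^'n" where
  "pullback g v = (\<chi> j. v $ g j)"

lemma norm_pullback: "g \<in> G \<Longrightarrow> norm (pullback g v) = norm v"
  using sum_reindex_G[of g "\<lambda>j. (v $ j)\<^sup>2"] by (simp add: pullback_def norm_vec_def L2_set_def)

lemma pullback_zero_sum: "g \<in> G \<Longrightarrow> v \<in> zero_sum \<Longrightarrow> pullback g v \<in> zero_sum"
  using sum_reindex_G[of g "\<lambda>j. v $ j"] by (simp add: pullback_def zero_sum_def)

lemma orbit_form_vec: "orbit_form v *v p = (\<Sum>g\<in>G. (pullback g v \<bullet> p) *\<^sub>R pullback g v)"
proof (rule vec_eq_iff[THEN iffD2, rule_format])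
  fix i
  have "(orbit_form v *v p) $ i = (\<Sum>j\<in>UNIV. \<Sum>g\<in>G. v $ g i * v $ g j * p $ j)"
    by (simp add: orbit_form_def matrix_vector_mult_def sum_distrib_right)
  also have "\<dots> = (\<Sum>g\<in>G. \<Sum>j\<in>UNIV. v $ g i * v $ g j * p $ j)"
    by (rule sum.swap)
  also have "\<dots> = (\<Sum>g\<in>G. (pullback g v \<bullet> p) *\<^sub>R pullback g v) $ i"
    by (simp add: pullback_def inner_vec_def sum_distrib_right sum_distrib_left mult_ac)
  finally show "(orbit_form v *v p) $ i = (\<Sum>g\<in>G. (pullback g v \<bullet> p) *\<^sub>R pullback g v) $ i" .
qed

lemma orbit_form_inner: "(orbit_form v *v p) \<bullet> p = (\<Sum>g\<in>G. (pullback g v \<bullet> p)\<^sup>2)"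
  by (simp add: orbit_form_vec inner_sum_left power2_eq_square)

lemma orbit_form_commutant0:
  assumes "v \<in> zero_sum"
  shows "orbit_form v \<in> commutant0"
proof (rule commutant0I)
  show "orbit_form v $ h i $ h j = orbit_form v $ i $ j" if "h \<in> G" for h i j
    using sum_mult_right_G[OF that, of "\<lambda>g. v $ g i * v $ g j"] by (simp add: orbit_form_def)
  show "(\<Sum>j\<in>UNIV. orbit_form v $ i $ j) = 0" for i
  proof -
    have "(\<Sum>j\<in>UNIV. orbit_form v $ i $ j) = (\<Sum>g\<in>G. \<Sum>j\<in>UNIV. v $ g i * v $ g j)"
      unfolding orbit_form_def by (simp add: sum.swap[of _ UNIV G])
    also have "\<dots> = (\<Sum>g\<in>G. v $ g i * (\<Sum>j\<in>UNIV. v $ j))"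
      by (simp add: sum_distrib_left[symmetric] sum_reindex_G cong: sum.cong)
    also have "\<dots> = 0" using assms by (simp add: zero_sum_def)
    finally show ?thesis .
  qed
qed

lemma orbit_form_transpose: "transpose (orbit_form v) = orbit_form v"
  by (simp add: orbit_form_def transpose_def mult.commute)

lemma norm_orbit_form_le:
  assumes "norm v = 1" "\<And>g. g \<in> G \<Longrightarrow> \<bar>pullback g v \<bullet> w\<bar> \<le> b"
  shows "norm (orbit_form v *v w) \<le> real (card G) * b"
proof -
  have "norm (orbit_form v *v w) \<le> (\<Sum>g\<in>G. norm ((pullback g v \<bullet> w) *\<^sub>R pullback g v))"
    unfolding orbit_form_vec by (rule norm_sum)
  also have "\<dots> \<le> (\<Sum>g\<in>G. b)"
    using assms by (intro sum_mono) (simp add: norm_pullback)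
  finally show ?thesis by simp
qed

lemma sum_values_at_base_ge: "(\<Sum>g\<in>G. (v $ g i0)\<^sup>2) \<ge> (norm v)\<^sup>2"
proof -
  have inj: "inj from_base"
    by (rule injI) (metis from_base(2))
  have "(norm v)\<^sup>2 = (\<Sum>j\<in>UNIV. (v $ from_base j i0)\<^sup>2)"
    unfolding power2_norm_eq_inner by (simp add: inner_vec_def from_base power2_eq_square)
  also have "\<dots> = (\<Sum>g\<in>range from_base. (v $ g i0)\<^sup>2)"
    by (simp add: sum.reindex[OF inj])
  also have "\<dots> \<le> (\<Sum>g\<in>G. (v $ g i0)\<^sup>2)"
    by (intro sum_mono2) (auto simp: from_base)
  finally show ?thesis .
qed

text \<open>The quadratic form of \<open>orbit_form v\<close> is nonnegative, so the twist expands all vectors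
  by at least \<open>s\<close>, and at the coordinate vector of the base point the form is at least
  \<open>|v|\<^sup>2 = 1\<close>.  Therefore one vector is stretched by at least \<open>4 s K\<close>, and \<open>modulus_ge\<close> applies.\<close>
lemma modulus_twist_orbit_form:
  assumes v: "v \<in> zero_sum" "norm v = 1" and s: "0 < s" "s \<le> 1"
  shows "modulus (twist (s *\<^sub>R centring + (4 * s * real K) *\<^sub>R orbit_form v)) \<ge> (real K + 1) * (s / 2) ^ CARD('n)"
proof -
  let ?t = "4 * s * real K"
  let ?A = "s *\<^sub>R centring + ?t *\<^sub>R orbit_form v"
  have A: "?A \<in> commutant0"
    by (intro commutant0_add commutant0_scaleR centring_commutant0 orbit_form_commutant0 v)
  have t: "?t \<ge> 0" using s by simp
  have Aproj: "?A *v proj p = s *\<^sub>R proj p + ?t *\<^sub>R (orbit_form v *v proj p)" for p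
    by (simp add: matrix_vector_mult_add_rdistrib scaleR_matrix_vector_assoc[symmetric] centring_vec
        centred_id zero_sum_proj)
  have in_eq: "twist ?A p \<bullet> p = s * (norm (proj p))\<^sup>2 + ?t * (\<Sum>g\<in>G. (pullback g v \<bullet> proj p)\<^sup>2)
      + (norm (p - proj p))\<^sup>2" for p
    unfolding inner_twist[OF A] Aproj
    by (simp add: inner_add_left orbit_form_inner power2_norm_eq_inner)
  have lower: "norm (twist ?A p) \<ge> s * norm p" for p
  proof (cases "p = 0")
    case False
    have "s * (norm p)\<^sup>2 = s * (norm (proj p))\<^sup>2 + s * (norm (p - proj p))\<^sup>2"
      using norm_proj_Pythagoras[of p] by (simp add: distrib_left)
    also have "\<dots> \<le> s * (norm (proj p))\<^sup>2 + (norm (p - proj p))\<^sup>2"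
      using s by (simp add: mult_left_le_one_le)
    also have "\<dots> \<le> twist ?A p \<bullet> p"
      unfolding in_eq using t by (simp add: sum_nonneg)
    also have "\<dots> \<le> norm (twist ?A p) * norm p" by (rule norm_cauchy_schwarz)
    finally show ?thesis using False by (simp add: power2_eq_square mult.assoc[symmetric])
  qed simp
  define e where "e = (axis i0 1 :: real^'n)"
  have e1: "norm e = 1" by (simp add: e_def)
  have proj_e: "proj e = e - vec (1 / real CARD('n))"
  proof (rule vec_eq_iff[THEN iffD2, rule_format])
    fix j
    have "e $ h j = e $ j" if "h \<in> stab" for h
    proof -
      have "h i0 = i0" using that by (simp add: stab_def)
      then have "h j = i0 \<longleftrightarrow> j = i0" using inj_eq[OF bij_is_inj[OF bij_G[OF stab_G[OF that]]], of j i0] by simp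
      then show ?thesis by (simp add: e_def axis_def)
    qed
    then have "(\<Sum>h\<in>stab. e $ h j) = real (card stab) * e $ j" by simp
    moreover have "mean e = 1 / real CARD('n)" by (simp add: mean_def e_def axis_def)
    ultimately show "proj e $ j = (e - vec (1 / real CARD('n))) $ j"
      using card_stab by (simp add: proj_def)
  qed
  have "pullback g v \<bullet> proj e = v $ g i0" if "g \<in> G" for g
  proof -
    have "pullback g v \<bullet> proj e = pullback g v \<bullet> e"
      unfolding proj_e inner_diff_right using pullback_zero_sum[OF that v(1)]
      by (simp add: inner_vec_def[of _ "vec _"] zero_sum_def sum_divide_distrib[symmetric])
    then show ?thesis by (simp add: e_def inner_axis pullback_def)
  qed
  then have "?t * 1 \<le> ?t * (\<Sum>g\<in>G. (pullback g v \<bullet> proj e)\<^sup>2)"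
    using sum_values_at_base_ge[of v] v(2) t by (intro mult_left_mono) simp_all
  also have "\<dots> \<le> twist ?A e \<bullet> e" unfolding in_eq using s by simp
  also have "\<dots> \<le> norm (twist ?A e) * norm e" by (rule norm_cauchy_schwarz)
  finally have e2: "norm (twist ?A e) \<ge> 4 * s * real K" using e1 by simp
  show ?thesis by (rule modulus_ge[OF linear_twist lower s(1) e1 e2])
qed

section \<open>Core points\<close>

lemma perm_matrix_pullback: "g \<in> G \<Longrightarrow> v \<bullet> (perm_matrix g *v w) = pullback g v \<bullet> w"
  using perm_matrix_inner[of g w v] by (simp add: inner_commute pullback_def inner_vec_def mult.commute)

lemma mean_perm: "g \<in> G \<Longrightarrow> mean (perm_matrix g *v w) = mean w"
  using sum_reindex_G[of g "\<lambda>j. (perm_matrix g *v w) $ j"] by (simp add: mean_def perm_matrix_nth)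

lemma norm_perm: "g \<in> G \<Longrightarrow> norm (perm_matrix g *v w) = norm w"
  using sum_reindex_G[of g "\<lambda>j. ((perm_matrix g *v w) $ j)\<^sup>2"]
  by (simp add: norm_vec_def L2_set_def perm_matrix_nth)

lemma norm_centred_perm:
  assumes "g \<in> G"
  shows "norm (centred (perm_matrix g *v w)) = norm (centred w)"
proof (rule power2_eq_imp_eq)
  show "(norm (centred (perm_matrix g *v w)))\<^sup>2 = (norm (centred w))\<^sup>2"
    using norm_centred[of w] norm_centred[of "perm_matrix g *v w"] norm_perm[OF assms, of w]
      mean_perm[OF assms, of w] by simp
qed auto

text \<open>The sum is invariant under the group, hence constant by transitivity, and has zero sum.\<close>
lemma sum_pullback:
  assumes "v \<in> zero_sum"
  shows "(\<Sum>g\<in>G. pullback g v) = 0"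
proof -
  define S where "S j = (\<Sum>g\<in>G. v $ g j)" for j
  have "S j = S i0" for j
  proof -
    obtain h where h: "h \<in> G" "h i0 = j" by (rule move_to)
    show ?thesis
      using sum_mult_right_G[OF h(1), of "\<lambda>g. v $ g i0"] h(2) by (simp add: S_def)
  qed
  then have const: "S = (\<lambda>_. S i0)" by blast
  have "real CARD('n) * S i0 = (\<Sum>j\<in>UNIV. S j)" by (subst (2) const) simp
  also have "\<dots> = (\<Sum>g\<in>G. \<Sum>j\<in>UNIV. v $ g j)"
    unfolding S_def by (rule sum.swap)
  also have "\<dots> = 0" using assms sum_reindex_G[of _ "\<lambda>j. v $ j"] by (simp add: zero_sum_def)
  finally have "S i0 = 0" by simp
  then have "S j = 0" for j using fun_cong[OF const, of j] by simp
  then show ?thesis by (simp add: vec_eq_iff pullback_def S_def)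
qed

text \<open>An integral point \<open>y\<close> with the coordinate sum of \<open>w\<close> and with centred part of norm at most
  \<open>d\<close> either belongs to the hull of the orbit, hence to the orbit, or is separated from the hull.  In the
  second case the normal vector \<open>v\<close> bounds all \<open>\<langle>g v, w\<rangle>\<close> from above, and as they sum to zero, also
  from below.\<close>
lemma core_point_narrow:
  assumes core: "core_point G w"
  shows "norm (centred w) \<le> real CARD('n) \<or>
    (\<exists>v\<in>zero_sum. norm v = 1 \<and> (\<forall>g\<in>G. \<bar>pullback g v \<bullet> w\<bar> \<le> real (card G) * real CARD('n)))"
proof -
  have wint: "w \<in> int_lattice" using core by (simp add: core_point_def)
  then have "(\<Sum>i\<in>UNIV. w $ i) \<in> \<int>" by (intro Ints_sum) (simp add: int_lattice_def)
  then obtain k :: int where k: "(\<Sum>i\<in>UNIV. w $ i) = of_int k" by (auto elim: Ints_cases)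
  define d where "d = int CARD('n)"
  have d: "d > 0" by (simp add: d_def)
  (* A constant integral vector plus a multiple of one coordinate vector: not the closest
     point to the barycentre, but at bounded distance from it. *)
  define x :: "real^'n" where "x = of_int (k mod d) *\<^sub>R axis i0 1"
  define y where "y = x + vec (of_int (k div d))"
  have y: "y \<in> int_lattice" by (simp add: y_def x_def int_lattice_def axis_def)
  have "(\<Sum>i\<in>UNIV. y $ i) = of_int (k mod d) + real CARD('n) * of_int (k div d)"
    by (simp add: y_def x_def axis_def sum.distrib sum_distrib_left[symmetric])
  also have "\<dots> = of_int (k mod d + d * (k div d))"
    unfolding d_def of_int_add of_int_mult by simp
  also have "\<dots> = of_int k" by simp
  finally have ysum: "(\<Sum>i\<in>UNIV. y $ i) = (\<Sum>i\<in>UNIV. w $ i)" using k by simp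
  have "norm (centred y) \<le> norm x" by (simp add: y_def centred_plus_const norm_centred_le)
  also have "norm x \<le> real CARD('n)"
  proof -
    have "0 \<le> k mod d" "k mod d < d" using d by auto
    then have "\<bar>real_of_int (k mod d)\<bar> \<le> real_of_int d" by linarith
    then show ?thesis by (simp add: x_def d_def)
  qed
  finally have ny: "norm (centred y) \<le> real CARD('n)" .
  let ?H = "convex hull (orbit_of G w)"
  show ?thesis
  proof (cases "y \<in> ?H")
    case True
    then have "y \<in> orbit_of G w" using core y by (auto simp: core_point_def)
    then show ?thesis using ny by (auto simp: orbit_of_def norm_centred_perm)
  next
    case False
    have "compact ?H" by (intro compact_convex_hull finite_imp_compact) (simp add: orbit_of_def)
    then obtain a b where ab: "a \<bullet> y < b" "\<And>z. z \<in> ?H \<Longrightarrow> b < a \<bullet> z"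
      using separating_hyperplane_closed_point[OF convex_convex_hull _ False] compact_imp_closed by blast
    define u where "u = - centred a"
    have u: "u \<in> zero_sum" unfolding u_def by (intro subspace_neg subspace_zero_sum centred_zero_sum)
    have inn: "u \<bullet> z = - (a \<bullet> z)" if "z \<in> zero_sum" for z
      using inner_centred[OF that, of a] by (simp add: u_def inner_commute)
    have lt: "u \<bullet> (perm_matrix g *v w) < u \<bullet> y" if g: "g \<in> G" for g
    proof -
      have "perm_matrix g *v w \<in> ?H" using g by (intro hull_inc) (simp add: orbit_of_def)
      then have "a \<bullet> y < a \<bullet> (perm_matrix g *v w)" using ab by force
      moreover have "y - perm_matrix g *v w \<in> zero_sum"
        using mean_perm[OF g, of w] ysum by (simp add: zero_sum_def sum_subtractf mean_def)
      then have "u \<bullet> (y - perm_matrix g *v w) = - (a \<bullet> (y - perm_matrix g *v w))" by (rule inn)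
      ultimately show ?thesis by (simp add: inner_diff_right)
    qed
    then have "u \<noteq> 0" using lt[OF id_G] by auto
    define v where "v = (1 / norm u) *\<^sub>R u"
    have v: "v \<in> zero_sum" "norm v = 1"
      using u \<open>u \<noteq> 0\<close> by (auto simp: v_def intro: subspace_scale subspace_zero_sum)
    define f where "f g = pullback g v \<bullet> w" for g
    have f_le: "f g \<le> real CARD('n)" if g: "g \<in> G" for g
    proof -
      have "f g = v \<bullet> (perm_matrix g *v w)" by (simp add: f_def perm_matrix_pullback[OF g])
      also have "\<dots> \<le> v \<bullet> y" using lt[OF g] \<open>u \<noteq> 0\<close> by (simp add: v_def divide_right_mono)
      also have "\<dots> = v \<bullet> centred y" using inner_centred[OF v(1)] by simp
      also have "\<dots> \<le> norm v * norm (centred y)" by (rule norm_cauchy_schwarz)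
      finally show ?thesis using ny v(2) by simp
    qed
    have f_sum: "(\<Sum>g\<in>G. f g) = 0"
      unfolding f_def inner_sum_left[symmetric] sum_pullback[OF v(1)] by simp
    have "\<bar>f g\<bar> \<le> real (card G) * real CARD('n)" if g: "g \<in> G" for g
    proof -
      have c: "real (card G) \<ge> 1" using card_G_pos by simp
      have "- f g = (\<Sum>h\<in>G - {g}. f h)" using f_sum sum.remove[OF finite_G g, of f] by simp
      also have "\<dots> \<le> (\<Sum>h\<in>G - {g}. real CARD('n))" by (intro sum_mono f_le) auto
      also have "\<dots> = real (card (G - {g})) * real CARD('n)" by simp
      also have "\<dots> \<le> real (card G) * real CARD('n)"
        by (intro mult_right_mono) (auto simp: card_Diff1_le)
      finally have "- f g \<le> real (card G) * real CARD('n)" .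
      moreover have "f g \<le> real (card G) * real CARD('n)"
      proof -
        have "1 * real CARD('n) \<le> real (card G) * real CARD('n)" by (intro mult_right_mono c) simp
        then show ?thesis using f_le[OF g] by linarith
      qed
      ultimately show ?thesis by linarith
    qed
    with v show ?thesis by (auto simp: f_def)
  qed
qed

lemma integral_unit_vec:
  assumes "integral_unit D"
  shows "(mat 1 + D) *v w = (mat 1 + D) *v centred w + vec (mean w)" "(mat 1 + D) *v centred w \<in> zero_sum"
proof -
  have D: "D \<in> commutant0" using assms by (simp add: integral_unit_def)
  show "(mat 1 + D) *v w = (mat 1 + D) *v centred w + vec (mean w)"
    by (simp add: matrix_vector_mult_add_rdistrib commutant0_centred[OF D]) (simp add: centred_def)
  show "(mat 1 + D) *v centred w \<in> zero_sum"
    unfolding matrix_vector_mult_add_rdistrib matrix_vector_mul_lid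
    by (rule subspace_add[OF subspace_zero_sum centred_zero_sum commutant0_range[OF D]])
qed

text \<open>Apply \<open>unit_approximation\<close> to \<open>A = s + t Q\<close> with the orbit form \<open>Q\<close> of the vector of
  \<open>core_point_narrow\<close>.  The parameter \<open>s\<close> is chosen such that the constant \<open>c\<close> of the approximation gives
  \<open>c s = 1/2\<close>; then \<open>t\<close> is taken large enough to make the modulus of \<open>A\<close> large.\<close>
lemma minimal_core_point_bounded:
  assumes QI: "QI_group G"
  shows "\<exists>C\<ge>0. \<forall>w. core_point G w \<and> (\<forall>D. integral_unit D \<longrightarrow> norm w \<le> norm ((mat 1 + D) *v w))
     \<longrightarrow> norm (centred w) \<le> C"
proof (cases "CARD('n) \<ge> 2")
  case False
  have "CARD('n) > 0" by simp
  then have "CARD('n) = 1" using False by linarith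
  then obtain i :: 'n where "UNIV = {i}" using card_1_singletonE by blast
  then have i: "j = i" for j by (metis UNIV_I singletonD)
  have "centred w = 0" for w :: "real^'n"
  proof -
    have "centred w $ i = 0"
      using centred_zero_sum[of w] by (simp add: zero_sum_def \<open>UNIV = {i}\<close>)
    then show ?thesis using i by (metis vec_eq_iff zero_index)
  qed
  then show ?thesis by (intro exI[of _ 0]) simp
next
  case True
  obtain c where c: "c \<ge> 1" "\<And>A. A \<in> commutant0 \<Longrightarrow> transpose A = A \<Longrightarrow> modulus (twist A) * ball_volume > 1 \<Longrightarrow>
     \<exists>D. integral_unit D \<and> (\<forall>v\<in>zero_sum. norm ((mat 1 + D) *v v) \<le> c * norm (A *v v))"
    using unit_approximation[OF QI True] by blast
  define s where "s = 1 / (2 * c)"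
  have s: "0 < s" "s \<le> 1" using c(1) by (auto simp: s_def)
  obtain K :: nat where K: "1 / ((s / 2) ^ CARD('n) * ball_volume) < real K" using reals_Archimedean2 by blast
  have pos: "(s / 2) ^ CARD('n) * ball_volume > 0" using s ball_volume_pos by simp
  have K: "(real K + 1) * (s / 2) ^ CARD('n) * ball_volume > 1"
    using K pos by (simp add: pos_divide_less_eq distrib_right mult.assoc)
  define t where "t = 4 * s * real K"
  define b where "b = real (card G) * (real (card G) * real CARD('n))"
  define C where "C = max (real CARD('n)) (2 * c * t * b)"
  have "norm (centred w) \<le> C"
    if core: "core_point G w" and min: "\<And>D. integral_unit D \<Longrightarrow> norm w \<le> norm ((mat 1 + D) *v w)" for w
  proof (rule disjE[OF core_point_narrow[OF core]])
    assume "\<exists>v\<in>zero_sum. norm v = 1 \<and> (\<forall>g\<in>G. \<bar>pullback g v \<bullet> w\<bar> \<le> real (card G) * real CARD('n))"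
    then obtain v where v: "v \<in> zero_sum" "norm v = 1"
      "\<And>g. g \<in> G \<Longrightarrow> \<bar>pullback g v \<bullet> w\<bar> \<le> real (card G) * real CARD('n)" by blast
    define A where "A = s *\<^sub>R centring + t *\<^sub>R orbit_form v"
    have A: "A \<in> commutant0"
      unfolding A_def by (intro commutant0_add commutant0_scaleR centring_commutant0 orbit_form_commutant0 v)
    have At: "transpose A = A"
    proof -
      have "transpose centring = centring" by (auto simp: transpose_def centring_def vec_eq_iff)
      then show ?thesis
        using orbit_form_transpose[of v] by (simp add: A_def transpose_def vec_eq_iff)
    qed
    have "modulus (twist A) * ball_volume \<ge> (real K + 1) * (s / 2) ^ CARD('n) * ball_volume"
      using modulus_twist_orbit_form[OF v(1,2) s, of K] ball_volume_pos
      by (intro mult_right_mono) (simp_all add: A_def t_def)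
    then have "modulus (twist A) * ball_volume > 1" using K by linarith
    then obtain D where D: "integral_unit D"
      "\<And>x. x \<in> zero_sum \<Longrightarrow> norm ((mat 1 + D) *v x) \<le> c * norm (A *v x)"
      using c(2)[OF A At] by blast
    have "(norm w)\<^sup>2 \<le> (norm ((mat 1 + D) *v w))\<^sup>2"
      using min[OF D(1)] by (intro power_mono) auto
    then have "(norm (centred w))\<^sup>2 \<le> (norm ((mat 1 + D) *v centred w))\<^sup>2"
      unfolding integral_unit_vec(1)[OF D(1), of w] zero_sum_plus_const[OF integral_unit_vec(2)[OF D(1)]]
      using norm_centred[of w] by simp
    then have "norm (centred w) \<le> norm ((mat 1 + D) *v centred w)"
      by (rule power2_le_imp_le) simp
    also have "\<dots> \<le> c * norm (A *v centred w)" by (rule D(2)[OF centred_zero_sum])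
    also have "A *v centred w = s *\<^sub>R centred w + t *\<^sub>R (orbit_form v *v w)"
      unfolding commutant0_centred[OF A]
      by (simp add: A_def matrix_vector_mult_add_rdistrib scaleR_matrix_vector_assoc[symmetric] centring_vec)
    also have "c * norm \<dots> \<le> c * (s * norm (centred w) + t * b)"
    proof (intro mult_left_mono)
      have "norm (orbit_form v *v w) \<le> b"
        unfolding b_def by (rule norm_orbit_form_le[OF v(2,3)])
      moreover have t: "t \<ge> 0" using s by (simp add: t_def)
      ultimately have "t * norm (orbit_form v *v w) \<le> t * b" by (intro mult_left_mono)
      then show "norm (s *\<^sub>R centred w + t *\<^sub>R (orbit_form v *v w)) \<le> s * norm (centred w) + t * b"
        using norm_triangle_ineq[of "s *\<^sub>R centred w" "t *\<^sub>R (orbit_form v *v w)"] s t by simp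
    qed (use c in simp)
    also have "\<dots> = norm (centred w) / 2 + c * t * b" using c(1) by (simp add: s_def field_simps)
    finally show "norm (centred w) \<le> C" by (simp add: C_def)
  qed (simp add: C_def)
  then show ?thesis by (intro exI[of _ C]) (auto simp: C_def le_max_iff_disj)
qed

lemma GL_normalizerD:
  assumes "S \<in> GL_normalizer G"
  shows "S ** matrix_inv S = mat 1" "matrix_inv S ** S = mat 1"
    "int_matrix S" "int_matrix (matrix_inv S)"
    "\<And>g. g \<in> G \<Longrightarrow> \<exists>h\<in>G. matrix_inv S ** perm_matrix g ** S = perm_matrix h"
proof -
  have "invertible S" using assms by (simp add: GL_normalizer_def GL_int_def)
  then show "S ** matrix_inv S = mat 1" "matrix_inv S ** S = mat 1"
    unfolding invertible_def matrix_inv_def by (metis (mono_tags, lifting) someI_ex)+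
qed (use assms in \<open>auto simp: GL_normalizer_def GL_int_def int_matrix_def\<close>)

lemma matrix_inv_unique:
  fixes S :: "real^'n^'n"
  assumes "S ** T = mat 1"
  shows "matrix_inv S = T" "invertible S"
proof -
  have TS: "T ** S = mat 1" using assms by (rule matrix_left_right_inverse1)
  then show inv: "invertible S" using assms by (auto simp: invertible_def)
  then have "matrix_inv S ** S = mat 1"
    unfolding invertible_def matrix_inv_def by (metis (mono_tags, lifting) someI_ex)
  then have "matrix_inv S ** (S ** T) = T" by (simp only: matrix_mul_assoc) simp
  then show "matrix_inv S = T" using assms by simp
qed

lemma GL_normalizerI:
  assumes "S ** T = mat 1" "int_matrix S" "int_matrix T"
    "\<And>g. g \<in> G \<Longrightarrow> \<exists>h\<in>G. T ** perm_matrix g ** S = perm_matrix h"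
  shows "S \<in> GL_normalizer G"
  unfolding GL_normalizer_def GL_int_def mem_Collect_eq matrix_inv_unique(1)[OF assms(1)]
  using assms(2-4) matrix_inv_unique(2)[OF assms(1)] by (auto simp: int_matrix_def image_iff)

lemma integral_unit_normalizer:
  assumes "integral_unit D"
  shows "mat 1 + D \<in> GL_normalizer G"
proof -
  obtain D' where D: "D \<in> commutant0" "int_matrix D" and D': "int_matrix D'"
    "(mat 1 + D) ** (mat 1 + D') = mat 1"
    using assms by (auto simp: integral_unit_def)
  have int: "int_matrix (mat 1 + E)" if "int_matrix E" for E :: "real^'n^'n"
    using that by (auto simp: int_matrix_def mat_def)
  show ?thesis
  proof (rule GL_normalizerI[OF D'(2) int[OF D(2)] int[OF D'(1)]])
    fix g assume g: "g \<in> G"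
    have "perm_matrix g ** D = D ** perm_matrix g"
      using commutant0_perm[OF D(1) g] by (simp add: matrix_eq flip: matrix_vector_mul_assoc)
    then have "perm_matrix g ** (mat 1 + D) = (mat 1 + D) ** perm_matrix g"
      by (simp add: matrix_add_ldistrib mat_add_rdistrib)
    then have "(mat 1 + D') ** perm_matrix g ** (mat 1 + D) = (mat 1 + D') ** (mat 1 + D) ** perm_matrix g"
      by (simp only: matrix_mul_assoc[symmetric])
    also have "\<dots> = perm_matrix g" by (simp add: matrix_left_right_inverse1[OF D'(2)])
    finally show "\<exists>h\<in>G. (mat 1 + D') ** perm_matrix g ** (mat 1 + D) = perm_matrix h"
      using g by blast
  qed
qed

lemma core_point_image:
  assumes z: "core_point G z" and D: "integral_unit D" and b: "b \<in> Fix G" "b \<in> int_lattice"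
  shows "core_point G ((mat 1 + D) *v z + b)"
proof -
  let ?S = "mat 1 + D"
  let ?T = "matrix_inv ?S"
  note inv = GL_normalizerD(1,2)[OF integral_unit_normalizer[OF D]]
    and Sint = GL_normalizerD(3,4)[OF integral_unit_normalizer[OF D]]
  have comm: "perm_matrix g *v (?S *v x + b) = ?S *v (perm_matrix g *v x) + b" if g: "g \<in> G" for g x
    using commutant0_perm[of D g x] D b(1) g
    by (simp add: integral_unit_def Fix_def matrix_vector_mult_add_rdistrib matrix_vector_right_distrib)
  let ?f = "\<lambda>x. ?S *v x + b"
  have orb: "orbit_of G (?f z) = ?f ` orbit_of G z"
    unfolding orbit_of_def image_image by (intro image_cong refl comm)
  have "?f ` X = (\<lambda>x. b + x) ` ((*v) ?S) ` X" for X by (simp add: image_image add.commute)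
  then have hull: "convex hull (?f ` X) = ?f ` (convex hull X)" for X
    by (simp only: convex_hull_translation convex_hull_linear_image[OF matrix_vector_mul_linear, symmetric])
  have zint: "z \<in> int_lattice" using z by (simp add: core_point_def)
  have int: "?f x \<in> int_lattice \<longleftrightarrow> x \<in> int_lattice" for x
  proof
    assume "?f x \<in> int_lattice"
    then have "?T *v (?f x - b) \<in> int_lattice"
      by (intro int_matrix_vec int_lattice_diff Sint b)
    then show "x \<in> int_lattice" by (simp add: matrix_vector_mul_assoc inv)
  qed (intro int_lattice_add int_matrix_vec Sint b)
  have "convex hull (orbit_of G (?f z)) \<inter> int_lattice = ?f ` (convex hull (orbit_of G z) \<inter> int_lattice)"
    unfolding orb hull using int by auto
  also have "\<dots> = orbit_of G (?f z)" using z by (simp add: core_point_def orb)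
  finally show ?thesis using int zint by (simp add: core_point_def)
qed

lemma norm_int_lattice: "v \<in> int_lattice \<Longrightarrow> (norm v)\<^sup>2 = real (nat \<lfloor>(norm v)\<^sup>2\<rfloor>)"
proof -
  assume "v \<in> int_lattice"
  then have "(norm v)\<^sup>2 \<in> \<int>"
    unfolding power2_norm_eq_inner inner_vec_def by (intro Ints_sum) (auto simp: int_lattice_def)
  then obtain k :: int where "(norm v)\<^sup>2 = of_int k" by (auto elim: Ints_cases)
  moreover then have "k \<ge> 0" using zero_le_power2[of "norm v"] by simp
  ultimately show ?thesis by simp
qed

text \<open>Squared norms of integral vectors are natural numbers, so a minimum over the units is attained;
  and composing with a further unit stays among the units.\<close>
lemma exists_minimal_unit:
  assumes z: "z \<in> int_lattice"
  shows "\<exists>D. integral_unit D \<and> (\<forall>E. integral_unit E \<longrightarrow>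
     norm ((mat 1 + D) *v z) \<le> norm ((mat 1 + E) *v ((mat 1 + D) *v z)))"
proof -
  define f where "f D = nat \<lfloor>(norm ((mat 1 + D) *v z))\<^sup>2\<rfloor>" for D
  obtain D where D: "integral_unit D" "\<And>E. integral_unit E \<Longrightarrow> f D \<le> f E"
    using ex_has_least_nat[of integral_unit 0 f] integral_unit_0 by blast
  have "norm ((mat 1 + D) *v z) \<le> norm ((mat 1 + E) *v ((mat 1 + D) *v z))" if E: "integral_unit E" for E
  proof (rule power2_le_imp_le)
    define F where "F = E + D + E ** D"
    have F: "integral_unit F" unfolding F_def by (rule integral_unit_comp[OF E D(1)])
    have lat: "(mat 1 + X) *v z \<in> int_lattice" if "integral_unit X" for X
      using that z by (intro int_matrix_vec) (auto simp: integral_unit_def int_matrix_def mat_def)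
    have "(norm ((mat 1 + D) *v z))\<^sup>2 \<le> (norm ((mat 1 + F) *v z))\<^sup>2"
      using norm_int_lattice[OF lat[OF D(1)]] norm_int_lattice[OF lat[OF F]] D(2)[OF F]
      unfolding f_def by linarith
    then show "(norm ((mat 1 + D) *v z))\<^sup>2 \<le> (norm ((mat 1 + E) *v ((mat 1 + D) *v z)))\<^sup>2"
      by (simp add: F_def matrix_vector_mul_assoc unit_mult)
  qed simp
  with D(1) show ?thesis by blast
qed

text \<open>The unit moves the point to one with bounded centred part, and subtracting the integral part of
  the mean bounds the remaining component.\<close>
lemma core_point_bounded_representative:
  assumes QI: "QI_group G"
  shows "\<exists>M. \<forall>z. core_point G z \<longrightarrow>
    (\<exists>w. core_point G w \<and> normalizer_equivalent G z w \<and> (norm w)\<^sup>2 \<le> M)"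
proof -
  obtain C where C: "C \<ge> 0" "\<And>w. core_point G w \<Longrightarrow>
      (\<And>D. integral_unit D \<Longrightarrow> norm w \<le> norm ((mat 1 + D) *v w)) \<Longrightarrow> norm (centred w) \<le> C"
    using minimal_core_point_bounded[OF QI] by blast
  have "\<exists>w. core_point G w \<and> normalizer_equivalent G z w \<and> (norm w)\<^sup>2 \<le> C\<^sup>2 + real CARD('n)"
    if z: "core_point G z" for z
  proof -
    obtain D where D: "integral_unit D"
      "\<And>E. integral_unit E \<Longrightarrow> norm ((mat 1 + D) *v z) \<le> norm ((mat 1 + E) *v ((mat 1 + D) *v z))"
      using exists_minimal_unit[of z] z by (auto simp: core_point_def)
    define w where "w = (mat 1 + D) *v z"
    have "core_point G w"
      using core_point_image[OF z D(1), of 0] by (simp add: w_def Fix_iff int_lattice_def)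
    then have cw: "norm (centred w) \<le> C" using C(2) D(2) by (simp add: w_def)
    define b :: "real^'n" where "b = vec (- of_int \<lfloor>mean w\<rfloor>)"
    have b: "b \<in> Fix G" "b \<in> int_lattice" by (simp_all add: b_def Fix_iff int_lattice_def)
    have "mean (w + b) = mean w - of_int \<lfloor>mean w\<rfloor>" by (simp add: b_def mean_add mean_vec del: vec_neg)
    then have "0 \<le> mean (w + b)" "mean (w + b) \<le> 1" by linarith+
    then have "(mean (w + b))\<^sup>2 \<le> 1" by (simp add: power_le_one)
    then have "real CARD('n) * (mean (w + b))\<^sup>2 \<le> real CARD('n)" by (simp add: mult_left_le)
    moreover have "centred (w + b) = centred w" unfolding b_def by (rule centred_plus_const)
    then have "(norm (centred (w + b)))\<^sup>2 \<le> C\<^sup>2" using cw by (simp add: power_mono)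
    ultimately have "(norm (w + b))\<^sup>2 \<le> C\<^sup>2 + real CARD('n)"
      using norm_centred[of "w + b"] by linarith
    moreover have "core_point G (w + b)" unfolding w_def by (rule core_point_image[OF z D(1) b])
    moreover have "normalizer_equivalent G z (w + b)"
      unfolding normalizer_equivalent_def w_def using integral_unit_normalizer[OF D(1)] b by blast
    ultimately show ?thesis by blast
  qed
  then show ?thesis by blast
qed

section \<open>Normalizer equivalence\<close>

text \<open>Conjugation by \<open>S\<close> is an injective self-map of a finite set of matrices, hence surjective.\<close>
lemma GL_normalizer_conj_surj:
  assumes "S \<in> GL_normalizer G" "g \<in> G"
  shows "\<exists>h\<in>G. S ** perm_matrix g ** matrix_inv S = perm_matrix h"
proof -
  let ?T = "matrix_inv S"
  let ?P = "perm_matrix ` G"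
  note S = GL_normalizerD[OF assms(1)]
  define \<phi> where "\<phi> X = ?T ** X ** S" for X
  have conj_inverse: "S ** \<phi> X ** ?T = X" for X
  proof -
    have "S ** \<phi> X ** ?T = (S ** ?T) ** X ** (S ** ?T)" by (simp only: \<phi>_def matrix_mul_assoc)
    then show ?thesis by (simp add: S)
  qed
  have "inj_on \<phi> ?P" by (rule inj_on_inverseI[of _ "\<lambda>X. S ** X ** ?T"]) (rule conj_inverse)
  moreover have "\<phi> ` ?P \<subseteq> ?P" using S(5) by (auto simp: \<phi>_def)
  moreover have "finite ?P" by simp
  ultimately have "\<phi> ` ?P = ?P" by (intro endo_inj_surj)
  then obtain h where "h \<in> G" "perm_matrix g = \<phi> (perm_matrix h)" using assms(2) by blast
  then show ?thesis using conj_inverse[of "perm_matrix h"] by auto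
qed

lemma GL_normalizer_Fix:
  assumes "S \<in> GL_normalizer G" "b \<in> Fix G"
  shows "S *v b \<in> Fix G"
  unfolding Fix_def
proof safe
  fix g assume "g \<in> G"
  note S = GL_normalizerD[OF assms(1)]
  obtain h where h: "h \<in> G" "matrix_inv S ** perm_matrix g ** S = perm_matrix h"
    using S(5)[OF \<open>g \<in> G\<close>] by blast
  have "perm_matrix g ** S = (S ** matrix_inv S) ** perm_matrix g ** S" by (simp add: S)
  also have "\<dots> = S ** perm_matrix h" by (simp only: h(2)[symmetric] matrix_mul_assoc)
  finally have "perm_matrix g *v (S *v b) = S *v (perm_matrix h *v b)"
    by (simp add: matrix_vector_mul_assoc)
  then show "perm_matrix g *v (S *v b) = S *v b" using assms(2) h(1) by (simp add: Fix_def)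
qed

lemma Fix_uminus: "b \<in> Fix G \<Longrightarrow> - b \<in> Fix G"
  unfolding Fix_iff by simp

lemma Fix_add: "b \<in> Fix G \<Longrightarrow> c \<in> Fix G \<Longrightarrow> b + c \<in> Fix G"
  by (simp add: Fix_def matrix_vector_right_distrib)

lemma normalizer_equivalent_sym:
  assumes "normalizer_equivalent G z w"
  shows "normalizer_equivalent G w z"
proof -
  obtain S b where S: "S \<in> GL_normalizer G" and b: "b \<in> Fix G" "b \<in> int_lattice" "w = S *v z + b"
    using assms by (auto simp: normalizer_equivalent_def)
  let ?T = "matrix_inv S"
  note SD = GL_normalizerD[OF S]
  have T: "?T \<in> GL_normalizer G"
    by (rule GL_normalizerI[of _ S]) (use SD GL_normalizer_conj_surj[OF S] in auto)
  have "?T *v (S *v z) = z" by (simp add: matrix_vector_mul_assoc SD)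
  then have "z = ?T *v w + ?T *v (- b)"
    by (simp add: b matrix_vector_right_distrib[symmetric])
  moreover have "?T *v (- b) \<in> Fix G" by (intro GL_normalizer_Fix[OF T] Fix_uminus b)
  moreover have "?T *v (- b) \<in> int_lattice"
    using b by (intro int_matrix_vec SD) (simp add: int_lattice_def)
  ultimately show ?thesis using T unfolding normalizer_equivalent_def by blast
qed

lemma normalizer_equivalent_trans:
  assumes "normalizer_equivalent G x y" "normalizer_equivalent G y z"
  shows "normalizer_equivalent G x z"
proof -
  obtain S b where S: "S \<in> GL_normalizer G" and b: "b \<in> Fix G" "b \<in> int_lattice" "y = S *v x + b"
    using assms(1) by (auto simp: normalizer_equivalent_def)
  obtain S' b' where S': "S' \<in> GL_normalizer G" and b': "b' \<in> Fix G" "b' \<in> int_lattice" "z = S' *v y + b'"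
    using assms(2) by (auto simp: normalizer_equivalent_def)
  note SD = GL_normalizerD[OF S] and SD' = GL_normalizerD[OF S']
  have "S' ** S \<in> GL_normalizer G"
  proof (rule GL_normalizerI[of _ "matrix_inv S ** matrix_inv S'"])
    have "S' ** S ** (matrix_inv S ** matrix_inv S') = S' ** (S ** matrix_inv S) ** matrix_inv S'"
      by (simp only: matrix_mul_assoc)
    then show "S' ** S ** (matrix_inv S ** matrix_inv S') = mat 1" by (simp add: SD SD')
    fix g assume "g \<in> G"
    then obtain h where h: "h \<in> G" "matrix_inv S' ** perm_matrix g ** S' = perm_matrix h"
      using SD'(5) by blast
    have "matrix_inv S ** matrix_inv S' ** perm_matrix g ** (S' ** S)
      = matrix_inv S ** (matrix_inv S' ** perm_matrix g ** S') ** S" by (simp only: matrix_mul_assoc)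
    then show "\<exists>h\<in>G. matrix_inv S ** matrix_inv S' ** perm_matrix g ** (S' ** S) = perm_matrix h"
      using SD(5)[OF h(1)] h(2) by simp
  qed (intro int_matrix_mult SD SD')+
  moreover have "z = (S' ** S) *v x + (S' *v b + b')"
    by (simp add: b b' matrix_vector_right_distrib matrix_vector_mul_assoc add.assoc)
  moreover have "S' *v b + b' \<in> Fix G" by (intro Fix_add GL_normalizer_Fix[OF S'] b b')
  moreover have "S' *v b + b' \<in> int_lattice" by (intro int_lattice_add int_matrix_vec SD' b b')
  ultimately show ?thesis unfolding normalizer_equivalent_def by blast
qed

lemma finite_bounded_int_lattice: "finite {v :: real^'m. v \<in> int_lattice \<and> (norm v)\<^sup>2 \<le> M}"
proof (rule finite_subset)
  let ?I = "{x \<in> \<int>. \<bar>x :: real\<bar> \<le> sqrt M}"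
  show "{v :: real^'m. v \<in> int_lattice \<and> (norm v)\<^sup>2 \<le> M} \<subseteq> vec_lambda ` (Pi\<^sub>E UNIV (\<lambda>_. ?I))"
  proof safe
    fix v :: "real^'m" assume v: "v \<in> int_lattice" "(norm v)\<^sup>2 \<le> M"
    have "norm v \<le> sqrt M" using v(2) by (rule real_le_rsqrt)
    then have "\<bar>v $ i\<bar> \<le> sqrt M" for i using component_le_norm_cart[of v i] by linarith
    then have "vec_nth v \<in> Pi\<^sub>E UNIV (\<lambda>_. ?I)" using v(1) by (auto simp: int_lattice_def)
    then show "v \<in> vec_lambda ` (Pi\<^sub>E UNIV (\<lambda>_. ?I))"
      by (rule image_eqI[of _ _ "vec_nth v", rotated]) simp
  qed
  show "finite (vec_lambda ` (Pi\<^sub>E (UNIV :: 'm set) (\<lambda>_. ?I)))"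
    by (intro finite_imageI finite_PiE finite_abs_int_segment) auto
qed

text \<open>Each class meets the finite set of integral vectors of bounded norm.\<close>
lemma finite_core_classes:
  assumes "QI_group G"
  shows "finite ({z. core_point G z} //
     {(z, w). core_point G z \<and> core_point G w \<and> normalizer_equivalent G z w})" (is "finite (?C // ?R)")
proof -
  obtain M where M: "\<And>z. core_point G z \<Longrightarrow>
    \<exists>w. core_point G w \<and> normalizer_equivalent G z w \<and> (norm w)\<^sup>2 \<le> M"
    using core_point_bounded_representative[OF assms] by blast
  let ?F = "{v :: real^'n. v \<in> int_lattice \<and> (norm v)\<^sup>2 \<le> M}"
  have "?C // ?R \<subseteq> (\<lambda>w. ?R `` {w}) ` ?F"
  proof
    fix X assume "X \<in> ?C // ?R"
    then obtain z where z: "core_point G z" "X = ?R `` {z}" by (auto simp: quotient_def)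
    obtain w where w: "core_point G w" "normalizer_equivalent G z w" "(norm w)\<^sup>2 \<le> M"
      using M[OF z(1)] by blast
    have "?R `` {z} = ?R `` {w}"
      using z(1) w(1,2) by (auto intro: normalizer_equivalent_trans normalizer_equivalent_sym)
    moreover have "w \<in> ?F" using w by (simp add: core_point_def)
    ultimately show "X \<in> (\<lambda>w. ?R `` {w}) ` ?F" using z(2) by blast
  qed
  then show ?thesis by (rule finite_subset) (intro finite_imageI finite_bounded_int_lattice)
qed

end

section \<open>Core points up to normalizer equivalence\<close>

theorem theorem5p1:
  fixes G :: "('n::finite \<Rightarrow> 'n) set"
  assumes "QI_group G"
  shows "(\<exists>M::real. \<forall>z. core_point G z \<longrightarrow>
            (\<exists>w. core_point G w \<and> normalizer_equivalent G z w \<and> (norm w)\<^sup>2 \<le> M)) \<and>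
         finite ({z. core_point G z} //
            {(z, w). core_point G z \<and> core_point G w \<and> normalizer_equivalent G z w})"
proof -
  interpret transitive_action G undefined
    by standard (use assms in \<open>simp add: QI_group_def\<close>)
  show ?thesis
    using core_point_bounded_representative[OF assms] finite_core_classes[OF assms] by blast
qed

end
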